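(* Let $(m_n)_{n\in\mathbb N}$ be a sequence of natural numbers with $m_n>1$ and let $G_n=(\mathrm{SL}_{m_n}(\mathbb C),\ell_J)$, where $\ell_J$ is the Jordan length. Any metric ultraproduct of $(G_n)_{n\in\mathbb N}$ (with respect to a non-principal ultrafilter on $\mathbb N$) is a simple group. In fact, it is metrically uniformly simple.
   Context: For a field $F$ and $A\in\mathrm{GL}_n(F)$ the Jordan length is $\ell_J(A)=\frac1n\min_{\lambda\in F^*}\mathrm{rk}(A-\lambda I_n)$; it is a bi-invariant pseudo-norm, i.e. $\ell_J(I_n)=0$, $\ell_J(AB)\le\ell_J(A)+\ell_J(B)$ and $\ell_J$ is invariant under inversion and conjugation. For a family $(G_n,\|\cdot\|_n)_n$ of groups with uniformly bounded pseudo-norms and a non-principal ultrafilter $\mathcal U$ on $\mathbb N$, the metric ultraproduct is $\prod_{n}G_n/\mathcal E$, $\mathcal E=\{(g_n) : \lim_{n\to\mathcal U}\|g_n\|_n=0\}$, with norm $\|(g_n)/\mathcal E\|=\lim_{n\to\mathcal U}\|g_n\|_n$. $C_N(g,G)$ is the set of all products of at most $N$ conjugates (in $G$) of $g$ and $g^{-1}$. $(G,\|\cdot\|)$ is metrically uniformly simple if for all $t>r>0$ there is $N\in\mathbb N$ such that $C_N(g,G)\supseteq\{h\in G : \|h\|<t\}$ for all $g\in G$ with $\|g\|\in(r,t]$. *)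

theory Defs
  imports Complex_Main "HOL-Algebra.Product_Groups" "Jordan_Normal_Form.DL_Rank"
begin

section \<open>Simple groups\<close>

text \<open>
  The locale \<open>simple_group\<close> of HOL-Algebra demands \<open>order G > 1\<close>, where \<open>order\<close> is \<open>card\<close> of the
  carrier and hence 0 for infinite groups: no infinite group satisfies it.  The following is
  the usual notion, without the restriction to finite groups.
\<close>

definition is_simple :: "('a, 'b) monoid_scheme \<Rightarrow> bool" where
  "is_simple G \<longleftrightarrow> group G \<and> carrier G \<noteq> {\<one>\<^bsub>G\<^esub>} \<and>
     (\<forall>H. H \<lhd> G \<longrightarrow> H = carrier G \<or> H = {\<one>\<^bsub>G\<^esub>})"

section \<open>Metric uniform simplicity\<close>

definition conjugates :: "('a, 'b) monoid_scheme \<Rightarrow> 'a \<Rightarrow> 'a set" where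
  "conjugates G g = {x \<otimes>\<^bsub>G\<^esub> g \<otimes>\<^bsub>G\<^esub> inv\<^bsub>G\<^esub> x | x. x \<in> carrier G}"

text \<open>
  Products of at most \<open>N\<close> conjugates of \<open>g\<close> and its inverse; the empty product \<open>\<one>\<close> is included.
\<close>

definition C_set :: "nat \<Rightarrow> 'a \<Rightarrow> ('a, 'b) monoid_scheme \<Rightarrow> 'a set" where
  "C_set N g G = {foldr (\<otimes>\<^bsub>G\<^esub>) xs \<one>\<^bsub>G\<^esub> | xs.
     length xs \<le> N \<and> set xs \<subseteq> conjugates G g \<union> conjugates G (inv\<^bsub>G\<^esub> g)}"

definition metrically_uniformly_simple :: "('a, 'b) monoid_scheme \<Rightarrow> ('a \<Rightarrow> real) \<Rightarrow> bool" where
  "metrically_uniformly_simple G l \<longleftrightarrow>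
     (\<forall>t r. t > r \<and> r > 0 \<longrightarrow>
        (\<exists>N. \<forall>g \<in> carrier G. l g \<in> {r<..t} \<longrightarrow> {h \<in> carrier G. l h < t} \<subseteq> C_set N g G))"

section \<open>Metric ultraproducts\<close>

definition is_ultrafilter :: "'i filter \<Rightarrow> bool" where
  "is_ultrafilter U \<longleftrightarrow>
     U \<noteq> bot \<and> (\<forall>P. eventually P U \<or> eventually (\<lambda>i. \<not> P i) U)"

definition nonprincipal :: "'i filter \<Rightarrow> bool" where
  "nonprincipal U \<longleftrightarrow> (\<forall>j. \<not> eventually (\<lambda>i. i = j) U)"

definition null_sequences ::
    "'i filter \<Rightarrow> ('i \<Rightarrow> 'a monoid) \<Rightarrow> ('i \<Rightarrow> 'a \<Rightarrow> real) \<Rightarrow> ('i \<Rightarrow> 'a) set" where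
  "null_sequences U G l =
     {g \<in> carrier (product_group UNIV G). ((\<lambda>i. l i (g i)) \<longlongrightarrow> 0) U}"

definition metric_ultraproduct ::
    "'i filter \<Rightarrow> ('i \<Rightarrow> 'a monoid) \<Rightarrow> ('i \<Rightarrow> 'a \<Rightarrow> real) \<Rightarrow> ('i \<Rightarrow> 'a) set monoid" where
  "metric_ultraproduct U G l = product_group UNIV G Mod null_sequences U G l"

text \<open>
  The norm of a coset is the ultralimit of the norms along a representative.  For uniformly
  bounded pseudo-norms and an ultrafilter the limit exists and is the same for every
  representative.
\<close>

definition ultraproduct_norm ::
    "'i filter \<Rightarrow> ('i \<Rightarrow> 'a \<Rightarrow> real) \<Rightarrow> ('i \<Rightarrow> 'a) set \<Rightarrow> real" where
  "ultraproduct_norm U l X = (THE c. \<forall>g \<in> X. ((\<lambda>i. l i (g i)) \<longlongrightarrow> c) U)"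

section \<open>Special linear groups and the Jordan length\<close>

definition special_linear_group :: "nat \<Rightarrow> 'a::field mat monoid" where
  "special_linear_group n =
     \<lparr>carrier = {A \<in> carrier_mat n n. det A = 1}, monoid.mult = (*), one = 1\<^sub>m n\<rparr>"

text \<open>Meant for \<open>n\<close> by \<open>n\<close> matrices; the set of ranks is then bounded by \<open>n\<close>, hence finite.\<close>

definition jordan_length :: "nat \<Rightarrow> 'a::field mat \<Rightarrow> real" where
  "jordan_length n A =
     1 / real n * real (Min {vec_space.rank n (A - c \<cdot>\<^sub>m 1\<^sub>m n) | c. c \<noteq> 0})"

end

theory Submission
  imports Defs "Jordan_Normal_Form.Schur_Decomposition" "Jordan_Normal_Form.Column_Operations"
begin

text \<open>
  Let \<open>g\<close> be an invertible complex matrix of size \<open>n\<close> with Jordan length at least \<open>r\<close>.  Splitting off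
  invariant planes on which \<open>g\<close> is not scalar, as long as possible, \<open>g\<close> becomes block upper triangular
  with \<open>d\<close> companion blocks of size 2, followed by a scalar block \<open>l\<close>; then \<open>g - l\<close> has rank at most
  \<open>2 d\<close>, so \<open>2 d \<ge> r n\<close>.  For a companion block \<open>C\<close> there is a conjugate of its inverse whose product with
  \<open>C\<close> is triangular with diagonal \<open>x, 1/x\<close> for any prescribed \<open>x\<close>.  Hence some
  conjugate of \<open>g\<close> times some conjugate of its inverse is similar to a diagonal matrix with \<open>2 d\<close>
  distinct entries different from 1 and all other entries equal to 1.

  By Sourour's factorization, a nonscalar matrix of determinant 1 is a product \<open>B C\<close> where \<open>B\<close> and \<open>C\<close>
  have prescribed distinct eigenvalues and the inverse eigenvalues, respectively.  Applied in size
  \<open>2 d\<close> it yields all positive diagonal matrices of determinant 1 supported on \<open>2 d\<close> positions, then,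
  moving the support along, a diagonal matrix with \<open>n\<close> distinct entries as a
  product of boundedly many conjugates; applied in size \<open>n\<close> it yields all nonscalar
  matrices of determinant 1.  The bound depends on \<open>r\<close> only and scalars have length 0, so the
  covering passes to the ultraproduct.
\<close>

section \<open>Rank and similarity\<close>

text \<open>All eigenvalues of \<open>g\<close> may coincide, so its spectrum alone offers nothing
  to work with. A conjugate of \<open>g\<close> times a conjugate of its inverse cures this: on each
  split plane the new eigenvalues are free, while the scalar block cancels to 1. Distinct
  eigenvalues are wanted throughout because they make triangular matrices diagonalizable, so that a
  similarity class is recognized from diagonal entries. Sourour's induction admits no scalar except
  the identity; positive entries meet this, since a positive scalar matrix of determinant 1 is the
  identity. A matrix supported on \<open>2 * d\<close> positions fixes only \<open>2 * d - 1\<close>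
  entries, the last one being spent on the determinant; as \<open>2 * d\<close> is at least
  \<open>r * n\<close> and \<open>d \<le> 2 * d - 1\<close>, about \<open>2 / r\<close> rounds fill
  the diagonal. A round costs two conjugate pairs and the factorization in size \<open>n\<close>
  doubles the total, whence \<open>4 * nat \<lceil>2 / r\<rceil>\<close> pairs. The complex field
  enters through triangular forms, which yield the planes, and through roots, which rescale
  conjugating matrices to determinant 1.\<close>

lemma obtain_inverse_mat:
  fixes P :: "'a :: field mat"
  assumes "P \<in> carrier_mat n n" "det P \<noteq> 0"
  obtains Q where "Q \<in> carrier_mat n n" "Q * P = 1\<^sub>m n" "P * Q = 1\<^sub>m n"
  using det_non_zero_imp_unit[OF assms, of n] unfolding Units_def ring_mat_def by auto

text \<open>Only an invertible intertwining matrix has to be exhibited; its inverse need not be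
  written down.\<close>

lemma similar_matI_intertwine:
  fixes A :: "'a :: field mat"
  assumes A: "A \<in> carrier_mat n n" and B: "B \<in> carrier_mat n n" and P: "P \<in> carrier_mat n n"
    and det: "det P \<noteq> 0" and AP: "A * P = P * B"
  shows "similar_mat A B"
proof -
  obtain Q where Q: "Q \<in> carrier_mat n n" "Q * P = 1\<^sub>m n" "P * Q = 1\<^sub>m n"
    using obtain_inverse_mat[OF P det] .
  have "A = A * (P * Q)" using Q A by simp
  also have "\<dots> = P * B * Q" using assoc_mult_mat[OF A P Q(1)] AP by simp
  finally show ?thesis
    by (intro similar_matI[of _ _ P Q n]) (use A B P Q in auto)
qed

context vec_space
begin

text \<open>The columns of \<open>A * B\<close> are combinations of those of \<open>A\<close>, so
  the column spaces are nested.\<close>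

lemma rank_mult_le:
  assumes A: "A \<in> carrier_mat n k" and B: "B \<in> carrier_mat k nc"
  shows "rank (A * B) \<le> rank A"
proof -
  have cA: "set (cols A) \<subseteq> carrier_vec n" and cAB: "set (cols (A * B)) \<subseteq> carrier_vec n"
    using cols_dim[of A] cols_dim[of "A * B"] A by auto
  have "set (cols (A * B)) \<subseteq> col_space A"
  proof
    fix x assume "x \<in> set (cols (A * B))"
    then obtain j where j: "j < nc" "x = col (A * B) j"
      using A B by (auto simp: cols_def)
    then have "x = A *\<^sub>v col B j" using col_mult2[OF A B] by simp
    moreover have "x \<in> carrier_vec n" using j A B by (auto intro!: carrier_vecI)
    ultimately show "x \<in> col_space A" using A B j by (auto simp: col_space_eq[OF A])
  qed
  then have sub: "span (set (cols (A * B))) \<subseteq> span (set (cols A))"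
    using cA col_space_def span_is_subset[OF _ span_is_submodule[OF cA]] by auto
  have "VectorSpace.subspace class_ring (span (set (cols A))) V"
    using cA span_is_subspace by blast
  moreover have "VectorSpace.subspace class_ring (span (set (cols (A * B)))) V"
    using cAB span_is_subspace by blast
  ultimately have "VectorSpace.subspace class_ring (span (set (cols (A * B)))) (vs (span (set (cols A))))"
    using nested_subspaces sub by blast
  moreover have "vectorspace.fin_dim class_ring (span_vs (set (cols A)))"
    using A fin_dim_span_cols by blast
  moreover have "vectorspace class_ring (span_vs (set (cols A)))"
    using \<open>VectorSpace.subspace class_ring (span (set (cols A))) V\<close> subspace_is_vs by blast
  moreover have "vectorspace.fin_dim class_ring (span_vs (set (cols (A * B))))"
    using fin_dim_span_cols mult_carrier_mat[OF A B] by blast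
  ultimately show ?thesis
    unfolding rank_def using vectorspace.subspace_dim[of class_ring "span_vs (set (cols A))"
      "span (set (cols (A * B)))"] by simp
qed

lemma rank_mult_le_inner:
  assumes "A \<in> carrier_mat n k" "B \<in> carrier_mat k nc"
  shows "rank (A * B) \<le> k"
  using rank_mult_le[OF assms] rank_le_nc[OF assms(1)] by linarith

text \<open>\<open>U\<close> collects a maximal independent set of columns of \<open>A\<close>, and
  \<open>W\<close> holds the coordinates of all columns with respect to it.\<close>

lemma rank_factorization:
  assumes A: "A \<in> carrier_mat n nc"
  obtains U W where "U \<in> carrier_mat n (rank A)" "W \<in> carrier_mat (rank A) nc" "A = U * W"
proof -
  have cA: "set (cols A) \<subseteq> carrier_vec n"
    using A cols_dim[of A] by auto
  obtain S where S: "maximal S (\<lambda>T. T \<subseteq> set (cols A) \<and> lin_indpt T)"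
    using maximal_exists[of "(\<lambda>T. T \<subseteq> set (cols A) \<and> lin_indpt T)" "card (set (cols A))" "{}"]
    by (meson List.finite_set card_mono empty_iff empty_subsetI finite_lin_indpt2 rev_finite_subset)
  have rk: "rank A = card S" using rank_card_indpt[OF A S] .
  have S1: "S \<subseteq> set (cols A)" "lin_indpt S" using S unfolding maximal_def by auto
  have finS: "finite S" using S1 finite_subset by blast
  then obtain xs where xs: "set xs = S" "distinct xs" using finite_distinct_list by blast
  have SC: "S \<subseteq> carrier_vec n" using S1 cA by auto
  define U where "U = mat_of_cols n xs"
  have len: "length xs = rank A" using rk xs distinct_card by metis
  have U: "U \<in> carrier_mat n (rank A)" unfolding U_def using len by auto
  have cU: "cols U = xs" unfolding U_def using cols_mat_of_cols SC xs by blast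
  have "col A j \<in> span S" if j: "j < nc" for j
  proof (rule ccontr)
    assume no: "col A j \<notin> span S"
    have cj: "col A j \<in> set (cols A)" using A j by (auto simp: cols_def)
    have "col A j \<in> carrier_vec n" "col A j \<notin> S" using cj cA no in_own_span[OF SC] by auto
    then have "lin_indpt (S \<union> {col A j})"
      using no S1(2) SC lin_dep_iff_in_span by blast
    then have "S \<union> {col A j} = S" using S cj S1 unfolding maximal_def by blast
    then show False using no in_own_span[OF SC] by auto
  qed
  then have "\<exists>x\<in>carrier_vec (rank A). U *\<^sub>v x = col A j" if "j < nc" for j
    using that col_space_eq[OF U] U unfolding col_space_def cU xs by auto
  then obtain f where f: "\<And>j. j < nc \<Longrightarrow> f j \<in> carrier_vec (rank A) \<and> U *\<^sub>v f j = col A j"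
    by metis
  define W where "W = mat_of_cols (rank A) (map f [0..<nc])"
  have W: "W \<in> carrier_mat (rank A) nc" unfolding W_def using mat_of_cols_carrier(1)[of "rank A" "map f [0..<nc]"] by simp
  have "A = U * W"
  proof (rule mat_col_eqI)
    show "dim_row A = dim_row (U * W)" "dim_col A = dim_col (U * W)" using A U W by auto
    fix j assume "j < dim_col (U * W)"
    then have j: "j < nc" using W by auto
    have "col W j = f j" unfolding W_def using j f
      by (subst col_mat_of_cols) auto
    then show "col A j = col (U * W) j" using f j col_mult2[OF U W j] by auto
  qed
  then show thesis using that U W by blast
qed

end

text \<open>Factoring \<open>B\<close> through dimension \<open>rank B\<close> factors
  \<open>A * B\<close> through the same dimension, which transfers the column bound to the right
  factor without transposes.\<close>

lemma rank_mult_le_right: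
  fixes A B :: "'a::field mat"
  assumes A: "A \<in> carrier_mat nr n" and B: "B \<in> carrier_mat n nc"
  shows "vec_space.rank nr (A * B) \<le> vec_space.rank n B"
proof -
  obtain U W where UW: "U \<in> carrier_mat n (vec_space.rank n B)" "W \<in> carrier_mat (vec_space.rank n B) nc"
    "B = U * W" using vec_space.rank_factorization[OF B] by blast
  have "A * B = (A * U) * W" unfolding UW(3) using assoc_mult_mat[OF A UW(1,2)] by simp
  then show ?thesis using vec_space.rank_mult_le_inner[OF mult_carrier_mat[OF A UW(1)] UW(2)] by simp
qed

lemma rank_similar_le:
  fixes A B :: "'a::field mat"
  assumes A: "A \<in> carrier_mat n n" and "similar_mat A B"
  shows "vec_space.rank n A \<le> vec_space.rank n B"
proof -
  obtain P Q where w: "similar_mat_wit A B P Q" using assms unfolding similar_mat_def by auto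
  note d = similar_mat_witD2[OF A w]
  have "vec_space.rank n A \<le> vec_space.rank n (P * B)"
    unfolding d(3) using vec_space.rank_mult_le[of "P * B" n n Q n] d by auto
  also have "\<dots> \<le> vec_space.rank n B" using rank_mult_le_right d by blast
  finally show ?thesis .
qed

lemma similar_mat_carrier:
  assumes "similar_mat A B" "A \<in> carrier_mat n n"
  shows "B \<in> carrier_mat n n"
  using assms similar_mat_witD2(5) unfolding similar_mat_def by blast

lemma rank_similar:
  fixes A B :: "'a::field mat"
  assumes "A \<in> carrier_mat n n" "similar_mat A B"
  shows "vec_space.rank n A = vec_space.rank n B"
  using rank_similar_le[OF assms] rank_similar_le[OF similar_mat_carrier[OF assms(2,1)] similar_mat_sym[OF assms(2)]]
  by simp

lemma similar_minus_scalar: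
  fixes A B :: "'a::field mat"
  assumes A: "A \<in> carrier_mat n n" and w: "similar_mat_wit A B P Q"
  shows "A - c \<cdot>\<^sub>m 1\<^sub>m n = P * (B - c \<cdot>\<^sub>m 1\<^sub>m n) * Q"
proof -
  note d = similar_mat_witD2[OF A w]
  have "P * (B - c \<cdot>\<^sub>m 1\<^sub>m n) = P * B - c \<cdot>\<^sub>m P"
    using d(4-7) by (subst mult_minus_distrib_mat[of _ n n _ n]) (auto simp: mult_smult_distrib)
  also have "\<dots> * Q = P * B * Q - c \<cdot>\<^sub>m (P * Q)"
    using d(4-7) by (subst minus_mult_distrib_mat[of _ n n _ _ n]) (auto simp: mult_smult_assoc_mat[of P n n])
  finally show ?thesis using d(1,3) by simp
qed

lemma similar_mat_minus_scalar:
  fixes A B :: "'a::field mat"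
  assumes A: "A \<in> carrier_mat n n" and "similar_mat A B"
  shows "similar_mat (A - c \<cdot>\<^sub>m 1\<^sub>m n) (B - c \<cdot>\<^sub>m 1\<^sub>m n)"
proof -
  obtain P Q where w: "similar_mat_wit A B P Q" using assms unfolding similar_mat_def by auto
  note d = similar_mat_witD2[OF A w]
  show ?thesis
    using d(4-7) by (intro similar_matI[OF _ d(1,2) similar_minus_scalar[OF A w]]) auto
qed

section \<open>Adapted bases\<close>

lemma obtain_mat_first_col:
  fixes x :: "'a::field vec"
  assumes x: "x \<in> carrier_vec n" "x \<noteq> 0\<^sub>v n"
  obtains Q where "Q \<in> carrier_mat n n" "det Q \<noteq> 0" "col Q 0 = x"
proof -
  interpret vec_space "TYPE('a)" n .
  define bs where "bs = basis_completion x"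
  note b = basis_completion[OF x, folded bs_def]
  define Q where "Q = mat_of_cols n bs"
  have Q: "Q \<in> carrier_mat n n" unfolding Q_def using b(6) mat_of_cols_carrier(1)[of n bs] by simp
  have cQ: "cols Q = bs" unfolding Q_def using b(2) by simp
  have "rank Q = n" using lin_indpt_full_rank[OF Q] cQ b by auto
  then have "det Q \<noteq> 0" using det_rank_iff[OF Q] by simp
  moreover have "col Q 0 = x"
  proof -
    have "n > 0" using x by (cases n) auto
    then have "col Q 0 = bs ! 0" using cQ Q cols_nth[of 0 Q] by auto
    also have "\<dots> = x" using b(6,7) \<open>n > 0\<close> by (cases bs) auto
    finally show ?thesis .
  qed
  ultimately show thesis using that Q by blast
qed

lemma mult_mat_unit_vec:
  fixes A :: "'a::semiring_1 mat"
  assumes "A \<in> carrier_mat nr n" "i < n"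
  shows "A *\<^sub>v unit_vec n i = col A i"
  using assms by (intro eq_vecI) auto

text \<open>Completion of a single vector, used twice. In the coordinates of a basis starting with
  \<open>v\<close>, the part of \<open>w\<close> past the first coordinate is nonzero because
  \<open>w\<close> is no multiple of \<open>v\<close>; it is completed to a basis in size
  \<open>m\<close>.\<close>

lemma obtain_mat_two_cols:
  fixes v w :: "'a::field vec"
  assumes n: "n \<ge> 2" and v: "v \<in> carrier_vec n" "v \<noteq> 0\<^sub>v n"
    and w: "w \<in> carrier_vec n" and ind: "\<And>c. w \<noteq> c \<cdot>\<^sub>v v"
  obtains P where "P \<in> carrier_mat n n" "det P \<noteq> 0" "col P 0 = v" "col P 1 = w"
proof -
  obtain m where m: "n = Suc m" "m > 0" using n by (cases n) auto
  obtain Q where Q: "Q \<in> carrier_mat n n" "det Q \<noteq> 0" "col Q 0 = v"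
    using obtain_mat_first_col[OF v] .
  obtain Qi where Qi: "Qi \<in> carrier_mat n n" "Qi * Q = 1\<^sub>m n" "Q * Qi = 1\<^sub>m n"
    using obtain_inverse_mat[OF Q(1,2)] .
  define u where "u = Qi *\<^sub>v w"
  have u: "u \<in> carrier_vec n" using Qi w unfolding u_def by auto
  have Qu: "Q *\<^sub>v u = w" unfolding u_def
    using assoc_mult_mat_vec[OF Q(1) Qi(1) w] Qi(3) w by simp
  have Qe: "Q *\<^sub>v unit_vec n 0 = v" using mult_mat_unit_vec[OF Q(1), of 0] Q n by simp
  define x where "x = vec m (\<lambda>i. u $ Suc i)"
  have x: "x \<in> carrier_vec m" unfolding x_def by auto
  have x0: "x \<noteq> 0\<^sub>v m"
  proof
    assume x0: "x = 0\<^sub>v m"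
    have "u = u $ 0 \<cdot>\<^sub>v unit_vec n 0"
    proof (rule eq_vecI)
      fix i assume "i < dim_vec (u $ 0 \<cdot>\<^sub>v unit_vec n 0)"
      then have i: "i < n" by simp
      have "u $ Suc j = 0" if "j < m" for j
        using that arg_cong[OF x0, of "\<lambda>y. y $ j"] unfolding x_def by simp
      then show "u $ i = (u $ 0 \<cdot>\<^sub>v unit_vec n 0) $ i"
        using i m by (cases i) auto
    qed (use u in auto)
    from arg_cong[OF this, of "\<lambda>y. Q *\<^sub>v y"] have "w = u $ 0 \<cdot>\<^sub>v v"
      unfolding Qu mult_mat_vec[OF Q(1) unit_vec_carrier] Qe .
    then show False using ind by blast
  qed
  obtain R where R: "R \<in> carrier_mat m m" "det R \<noteq> 0" "col R 0 = x"
    using obtain_mat_first_col[OF x x0] .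
  \<comment> \<open>The top row restores the first coordinate that \<open>x\<close> dropped, so the
    column of index 1 is all of \<open>u\<close>.\<close>
  define M where "M = four_block_mat (1\<^sub>m 1) (mat 1 m (\<lambda>(i,j). if j = 0 then u $ 0 else 0)) (0\<^sub>m m 1) R"
  have M: "M \<in> carrier_mat n n" unfolding M_def m(1) using R by auto
  have "det M = det R" unfolding M_def
    by (subst det_four_block_mat_lower_left_zero[of _ 1 _ m]) (use R in auto)
  then have dM: "det M \<noteq> 0" using R by simp
  have c0: "col M 0 = unit_vec n 0"
    by (rule eq_vecI) (use m R in \<open>auto simp: M_def\<close>)
  have Rx: "R $$ (i, 0) = u $ Suc i" if "i < m" for i
    using arg_cong[OF R(3), of "\<lambda>y. y $ i"] that R(1) m unfolding x_def by simp
  have c1: "col M 1 = u"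
    by (rule eq_vecI) (use m R Rx u in \<open>auto simp: M_def\<close>)
  show thesis
  proof (rule that)
    show "Q * M \<in> carrier_mat n n" using Q M by auto
    show "det (Q * M) \<noteq> 0" using det_mult[OF Q(1) M] Q dM by simp
    show "col (Q * M) 0 = v" using col_mult2[OF Q(1) M, of 0] n c0 Qe by simp
    show "col (Q * M) 1 = w" using col_mult2[OF Q(1) M, of 1] n c1 Qu by simp
  qed
qed

text \<open>The column facts are conditional because the two uses know different amounts: for
  companion blocks the plane of \<open>v\<close> and \<open>w\<close> is invariant, for Schur
  complements only the image of \<open>v\<close> is known to lie in it.\<close>

lemma similar_mat_adapted_basis:
  fixes A :: "'a::field mat"
  assumes A: "A \<in> carrier_mat n n" and n: "n \<ge> 2"
    and v: "v \<in> carrier_vec n" "v \<noteq> 0\<^sub>v n" and w: "w \<in> carrier_vec n" "\<And>c. w \<noteq> c \<cdot>\<^sub>v v"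
  obtains B where "B \<in> carrier_mat n n" "similar_mat A B"
    "\<And>a b. A *\<^sub>v v = a \<cdot>\<^sub>v v + b \<cdot>\<^sub>v w \<Longrightarrow> col B 0 = a \<cdot>\<^sub>v unit_vec n 0 + b \<cdot>\<^sub>v unit_vec n 1"
    "\<And>a b. A *\<^sub>v w = a \<cdot>\<^sub>v v + b \<cdot>\<^sub>v w \<Longrightarrow> col B 1 = a \<cdot>\<^sub>v unit_vec n 0 + b \<cdot>\<^sub>v unit_vec n 1"
proof -
  obtain P where P: "P \<in> carrier_mat n n" "det P \<noteq> 0" "col P 0 = v" "col P 1 = w"
    using obtain_mat_two_cols[OF n v w] .
  obtain Q where Q: "Q \<in> carrier_mat n n" "Q * P = 1\<^sub>m n" "P * Q = 1\<^sub>m n"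
    using obtain_inverse_mat[OF P(1,2)] .
  define B where "B = Q * (A * P)"
  have B: "B \<in> carrier_mat n n" unfolding B_def using A P Q by auto
  have AP: "A * P \<in> carrier_mat n n" using A P by auto
  have "P * B = A * P" unfolding B_def using assoc_mult_mat[OF P(1) Q(1) AP] Q(3) left_mult_one_mat[OF AP] by simp
  then have sim: "similar_mat A B" using similar_matI_intertwine[OF A B P(1,2)] by simp
  have Qv: "Q *\<^sub>v v = unit_vec n 0" "Q *\<^sub>v w = unit_vec n 1"
    using col_mult2[OF Q(1) P(1), of 0] col_mult2[OF Q(1) P(1), of 1] n P(3,4) Q(2) by auto
  have lin: "Q *\<^sub>v (a \<cdot>\<^sub>v v + b \<cdot>\<^sub>v w) = a \<cdot>\<^sub>v unit_vec n 0 + b \<cdot>\<^sub>v unit_vec n 1" for a b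
    using mult_add_distrib_mat_vec[OF Q(1), of "a \<cdot>\<^sub>v v" "b \<cdot>\<^sub>v w"] mult_mat_vec[OF Q(1) v(1), of a]
      mult_mat_vec[OF Q(1) w(1), of b] v w Qv by simp
  have col: "col B i = Q *\<^sub>v (A *\<^sub>v col P i)" if "i < n" for i
    unfolding B_def using col_mult2[OF Q(1) AP that] col_mult2[OF A P(1) that] by simp
  show thesis
    by (rule that[OF B sim]) (use col[of 0] col[of 1] n P lin in auto)
qed

section \<open>Nonscalar matrices and invariant planes\<close>

lemma nonscalar_moves_vec:
  fixes A :: "'a::field mat"
  assumes A: "A \<in> carrier_mat n n" and ns: "\<And>c. A \<noteq> c \<cdot>\<^sub>m 1\<^sub>m n"
  shows "\<exists>v\<in>carrier_vec n. \<forall>c. A *\<^sub>v v \<noteq> c \<cdot>\<^sub>v v"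
proof (rule ccontr)
  assume "\<not> ?thesis"
  then have ev: "\<exists>c. A *\<^sub>v v = c \<cdot>\<^sub>v v" if "v \<in> carrier_vec n" for v using that by blast
  have "\<exists>c. col A i = c \<cdot>\<^sub>v unit_vec n i" if "i < n" for i
    using ev[of "unit_vec n i"] mult_mat_unit_vec[OF A that] by simp
  then obtain f where f: "\<And>i. i < n \<Longrightarrow> col A i = f i \<cdot>\<^sub>v unit_vec n i" by metis
  have Aij: "A $$ (i,j) = (if i = j then f j else 0)" if "i < n" "j < n" for i j
    using arg_cong[OF f[OF that(2)], of "\<lambda>v. v $ i"] that A by auto
  \<comment> \<open>That the sum of two unit vectors is an eigenvector forces the two diagonal
    entries to agree.\<close>
  have "f i = f j" if ij: "i < n" "j < n" "i \<noteq> j" for i j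
  proof -
    obtain c where c: "A *\<^sub>v (unit_vec n i + unit_vec n j) = c \<cdot>\<^sub>v (unit_vec n i + unit_vec n j)"
      using ev[of "unit_vec n i + unit_vec n j"] by auto
    have "A *\<^sub>v (unit_vec n i + unit_vec n j) = col A i + col A j"
      using mult_add_distrib_mat_vec[OF A, of "unit_vec n i" "unit_vec n j"]
        mult_mat_unit_vec[OF A] ij by simp
    then have e: "f i \<cdot>\<^sub>v unit_vec n i + f j \<cdot>\<^sub>v unit_vec n j = c \<cdot>\<^sub>v (unit_vec n i + unit_vec n j)"
      using c f ij by simp
    show ?thesis
      using arg_cong[OF e, of "\<lambda>v. v $ i"] arg_cong[OF e, of "\<lambda>v. v $ j"] ij by auto
  qed
  then have f0: "f i = f 0" if "i < n" for i using that by (cases "i = 0") auto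
  have "A = f 0 \<cdot>\<^sub>m 1\<^sub>m n"
  proof (rule eq_matI)
    fix i j assume "i < dim_row (f 0 \<cdot>\<^sub>m 1\<^sub>m n)" "j < dim_col (f 0 \<cdot>\<^sub>m 1\<^sub>m n)"
    then show "A $$ (i, j) = (f 0 \<cdot>\<^sub>m 1\<^sub>m n) $$ (i, j)" using Aij[of i j] f0[of j] by simp
  qed (use A in auto)
  then show False using ns by blast
qed

text \<open>The vector found is annihilated by \<open>(T - l) (T - m)\<close>, where
  \<open>l\<close> is the first diagonal entry and \<open>m\<close> the one in the first column that
  differs from \<open>l\<close> times its unit vector. That column is \<open>m\<close> times a unit
  vector plus some \<open>c\<close> with \<open>T c = l c\<close>. If \<open>c\<close> is nonzero
  the unit vector serves; otherwise it is an eigenvector for \<open>m \<noteq> l\<close>, and adding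
  an eigenvector for \<open>l\<close> gives the required vector.\<close>

lemma upper_triangular_quadratic_vec:
  fixes T :: "'a::field mat"
  assumes T: "T \<in> carrier_mat n n" and ut: "upper_triangular T" and ns: "\<And>c. T \<noteq> c \<cdot>\<^sub>m 1\<^sub>m n"
  shows "\<exists>v\<in>carrier_vec n. (\<forall>c. T *\<^sub>v v \<noteq> c \<cdot>\<^sub>v v) \<and>
           (\<exists>s t. T *\<^sub>v (T *\<^sub>v v) = s \<cdot>\<^sub>v v + t \<cdot>\<^sub>v (T *\<^sub>v v))"
proof -
  define l where "l = T $$ (0,0)"
  let ?bad = "\<lambda>j. j < n \<and> col T j \<noteq> l \<cdot>\<^sub>v unit_vec n j"
  have "\<exists>j. ?bad j"
  proof (rule ccontr)
    assume no: "\<nexists>j. ?bad j"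
    have "T = l \<cdot>\<^sub>m 1\<^sub>m n"
    proof (rule mat_col_eqI)
      fix j assume "j < dim_col (l \<cdot>\<^sub>m 1\<^sub>m n)"
      then show "col T j = col (l \<cdot>\<^sub>m 1\<^sub>m n) j" using no by (auto simp: col_smult)
    qed (use T in auto)
    then show False using ns by blast
  qed
  \<comment> \<open>Minimality is what makes \<open>T\<close> act as \<open>l\<close> on all earlier
    unit vectors.\<close>
  define j where "j = (LEAST j. ?bad j)"
  have j: "j < n" "col T j \<noteq> l \<cdot>\<^sub>v unit_vec n j"
    using LeastI_ex[OF \<open>\<exists>j. ?bad j\<close>] unfolding j_def by blast+
  have less: "col T i = l \<cdot>\<^sub>v unit_vec n i" if "i < j" for i
    using not_less_Least[of i ?bad] that j unfolding j_def[symmetric] by auto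
  have Tki: "T $$ (k,i) = (if k = i then l else 0)" if "i < j" "k < n" for i k
    using arg_cong[OF less[OF that(1)], of "\<lambda>v. v $ k"] that j T by auto
  define m where "m = T $$ (j,j)"
  define c where "c = col T j - m \<cdot>\<^sub>v unit_vec n j"
  have c: "c \<in> carrier_vec n" unfolding c_def using T by auto
  have ck: "c $ k = (if k < j then T $$ (k,j) else 0)" if "k < n" for k
    using that j T upper_triangularD[OF ut, of j k] unfolding c_def m_def by auto
  have colj: "col T j = m \<cdot>\<^sub>v unit_vec n j + c"
    unfolding c_def using T by (intro eq_vecI) auto
  \<comment> \<open>By triangularity \<open>c\<close> is supported before \<open>j\<close>, where
    \<open>T\<close> acts as \<open>l\<close>.\<close>
  have Tc: "T *\<^sub>v c = l \<cdot>\<^sub>v c"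
  proof (rule eq_vecI)
    fix k assume "k < dim_vec (l \<cdot>\<^sub>v c)"
    then have k: "k < n" using c by simp
    have "(T *\<^sub>v c) $ k = (\<Sum>i\<in>{0..<n}. T $$ (k,i) * c $ i)"
      using k T c by (simp add: scalar_prod_def)
    also have "\<dots> = (\<Sum>i\<in>{0..<n}. if i = k then l * c $ k else 0)"
      by (rule sum.cong) (use k Tki ck in auto)
    also have "\<dots> = (l \<cdot>\<^sub>v c) $ k" using k c by simp
    finally show "(T *\<^sub>v c) $ k = (l \<cdot>\<^sub>v c) $ k" .
  qed (use T c in auto)
  show ?thesis
  proof (cases "c = 0\<^sub>v n")
    case False
    have Tv: "T *\<^sub>v unit_vec n j = m \<cdot>\<^sub>v unit_vec n j + c"
      using mult_mat_unit_vec[OF T j(1)] colj by simp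
    have "T *\<^sub>v (m \<cdot>\<^sub>v unit_vec n j + c) = m \<cdot>\<^sub>v (m \<cdot>\<^sub>v unit_vec n j + c) + l \<cdot>\<^sub>v c"
      using mult_add_distrib_mat_vec[OF T, of "m \<cdot>\<^sub>v unit_vec n j" c] c
        mult_mat_vec[OF T unit_vec_carrier, of m j] Tv Tc by simp
    also have "\<dots> = (- (l * m)) \<cdot>\<^sub>v unit_vec n j + (l + m) \<cdot>\<^sub>v (m \<cdot>\<^sub>v unit_vec n j + c)"
      using c by (intro eq_vecI) (auto simp: algebra_simps)
    finally have "T *\<^sub>v (T *\<^sub>v unit_vec n j) = (- (l * m)) \<cdot>\<^sub>v unit_vec n j + (l + m) \<cdot>\<^sub>v (T *\<^sub>v unit_vec n j)"
      using Tv by simp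
    moreover have "T *\<^sub>v unit_vec n j \<noteq> d \<cdot>\<^sub>v unit_vec n j" for d
    proof
      assume d: "T *\<^sub>v unit_vec n j = d \<cdot>\<^sub>v unit_vec n j"
      have "c = 0\<^sub>v n"
      proof (rule eq_vecI)
        fix k assume "k < dim_vec (0\<^sub>v n)"
        then have k: "k < n" by simp
        show "c $ k = 0\<^sub>v n $ k"
          using arg_cong[OF d[unfolded Tv], of "\<lambda>v. v $ k"] k c j ck[OF k] by (auto split: if_splits)
      qed (use c in simp)
      then show False using False by simp
    qed
    ultimately show ?thesis using unit_vec_carrier by blast
  next
    case True
    then have Tj: "T *\<^sub>v unit_vec n j = m \<cdot>\<^sub>v unit_vec n j"
      using mult_mat_unit_vec[OF T j(1)] colj by simp
    then have lm: "l \<noteq> m" using j mult_mat_unit_vec[OF T j(1)] by auto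
    then have j0: "0 < j" unfolding l_def m_def by (cases j) auto
    have T0: "T *\<^sub>v unit_vec n 0 = l \<cdot>\<^sub>v unit_vec n 0"
      using mult_mat_unit_vec[OF T, of 0] less[OF j0] j by simp
    have lin: "T *\<^sub>v (a \<cdot>\<^sub>v unit_vec n 0 + b \<cdot>\<^sub>v unit_vec n j) = (a * l) \<cdot>\<^sub>v unit_vec n 0 + (b * m) \<cdot>\<^sub>v unit_vec n j" for a b
      using mult_add_distrib_mat_vec[OF T, of "a \<cdot>\<^sub>v unit_vec n 0" "b \<cdot>\<^sub>v unit_vec n j"]
        mult_mat_vec[OF T unit_vec_carrier] T0 Tj by (simp add: smult_smult_assoc)
    \<comment> \<open>A sum of eigenvectors for the distinct values \<open>l\<close> and
      \<open>m\<close> is not an eigenvector. The coefficients 1 are kept to match the form of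
      \<open>lin\<close>.\<close>
    let ?v = "1 \<cdot>\<^sub>v unit_vec n 0 + 1 \<cdot>\<^sub>v unit_vec n j :: 'a vec"
    have "T *\<^sub>v ?v \<noteq> d \<cdot>\<^sub>v ?v" for d
    proof
      assume d: "T *\<^sub>v ?v = d \<cdot>\<^sub>v ?v"
      show False
        using arg_cong[OF d[unfolded lin], of "\<lambda>v. v $ 0"] arg_cong[OF d[unfolded lin], of "\<lambda>v. v $ j"] j j0 lm
        by auto
    qed
    moreover have "T *\<^sub>v (T *\<^sub>v ?v) = (- (l * m)) \<cdot>\<^sub>v ?v + (l + m) \<cdot>\<^sub>v (T *\<^sub>v ?v)"
      unfolding lin using j0 by (intro eq_vecI) (auto simp: algebra_simps)
    ultimately show ?thesis by (intro bexI[of _ ?v]) auto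
  qed
qed

text \<open>Over the complex numbers \<open>A\<close> is similar to a triangular matrix, and both
  properties of the vector pass through the similarity.\<close>

lemma quadratic_vec:
  fixes A :: "complex mat"
  assumes A: "A \<in> carrier_mat n n" and ns: "\<And>c. A \<noteq> c \<cdot>\<^sub>m 1\<^sub>m n"
  shows "\<exists>v\<in>carrier_vec n. (\<forall>c. A *\<^sub>v v \<noteq> c \<cdot>\<^sub>v v) \<and>
           (\<exists>s t. A *\<^sub>v (A *\<^sub>v v) = s \<cdot>\<^sub>v v + t \<cdot>\<^sub>v (A *\<^sub>v v))"
proof -
  obtain es where "char_poly A = (\<Prod>a\<leftarrow>es. [:- a, 1:])" using char_poly_factorized[OF A] by blast
  from schur_decomposition_exists[OF A this] obtain T P Q
    where T: "T \<in> carrier_mat n n" "upper_triangular T" and w: "similar_mat_wit A T P Q"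
    unfolding similar_mat_def by blast
  note d = similar_mat_witD2[OF A w]
  have "T \<noteq> c \<cdot>\<^sub>m 1\<^sub>m n" for c
  proof
    assume "T = c \<cdot>\<^sub>m 1\<^sub>m n"
    then have "A = c \<cdot>\<^sub>m (P * Q)" using d(3,6,7) mult_smult_distrib[OF d(6) one_carrier_mat]
        mult_smult_assoc_mat[OF d(6,7)] by simp
    then show False using ns d(1) by simp
  qed
  then obtain v s t where v: "v \<in> carrier_vec n" "\<And>c. T *\<^sub>v v \<noteq> c \<cdot>\<^sub>v v"
    and st: "T *\<^sub>v (T *\<^sub>v v) = s \<cdot>\<^sub>v v + t \<cdot>\<^sub>v (T *\<^sub>v v)"
    using upper_triangular_quadratic_vec[OF T] by blast
  have QP: "Q *\<^sub>v (P *\<^sub>v x) = x" if "x \<in> carrier_vec n" for x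
    using assoc_mult_mat_vec[OF d(7,6) that] d(2) that by simp
  have AP: "A *\<^sub>v (P *\<^sub>v x) = P *\<^sub>v (T *\<^sub>v x)" if "x \<in> carrier_vec n" for x
  proof -
    have "A *\<^sub>v (P *\<^sub>v x) = P * T *\<^sub>v (Q *\<^sub>v (P *\<^sub>v x))"
      unfolding d(3) using d(5-7) that by (intro assoc_mult_mat_vec[of _ n n]) auto
    then show ?thesis using QP[OF that] assoc_mult_mat_vec[OF d(6,5) that] by simp
  qed
  have Tv: "T *\<^sub>v v \<in> carrier_vec n" using T v by auto
  have "A *\<^sub>v (P *\<^sub>v v) \<noteq> c \<cdot>\<^sub>v (P *\<^sub>v v)" for c
  proof
    assume "A *\<^sub>v (P *\<^sub>v v) = c \<cdot>\<^sub>v (P *\<^sub>v v)"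
    then have "Q *\<^sub>v (P *\<^sub>v (T *\<^sub>v v)) = c \<cdot>\<^sub>v (Q *\<^sub>v (P *\<^sub>v v))"
      using AP[OF v(1)] mult_mat_vec[OF d(7), of "P *\<^sub>v v" c] d(6) v(1) by simp
    then show False using QP[OF v(1)] QP[OF Tv] v(2) by simp
  qed
  moreover have "A *\<^sub>v (A *\<^sub>v (P *\<^sub>v v)) = s \<cdot>\<^sub>v (P *\<^sub>v v) + t \<cdot>\<^sub>v (A *\<^sub>v (P *\<^sub>v v))"
    using AP[OF v(1)] AP[OF Tv] st mult_add_distrib_mat_vec[OF d(6), of "s \<cdot>\<^sub>v v" "t \<cdot>\<^sub>v (T *\<^sub>v v)"]
      mult_mat_vec[OF d(6) v(1)] mult_mat_vec[OF d(6) Tv] v(1) Tv by simp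
  moreover have "P *\<^sub>v v \<in> carrier_vec n" using d(6) v(1) by simp
  ultimately show ?thesis by blast
qed

definition mat2 :: "'a \<Rightarrow> 'a \<Rightarrow> 'a \<Rightarrow> 'a \<Rightarrow> 'a mat" where
  "mat2 a b c d = mat 2 2 (\<lambda>(i,j). if i = 0 then (if j = 0 then a else b) else (if j = 0 then c else d))"

lemma mat2_carrier[simp]: "mat2 a b c d \<in> carrier_mat 2 2"
  unfolding mat2_def by simp

text \<open>A basis starting with \<open>v\<close> and \<open>A v\<close>, for \<open>v\<close> as
  in \<open>quadratic_vec\<close>, gives an invariant plane. The block is the companion matrix of
  \<open>X^2 - t X - s\<close>.\<close>

lemma similar_mat_companion_block:
  fixes A :: "complex mat"
  assumes A: "A \<in> carrier_mat (2 + m) (2 + m)" and ns: "\<And>c. A \<noteq> c \<cdot>\<^sub>m 1\<^sub>m (2 + m)"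
  obtains s t Y D where "Y \<in> carrier_mat 2 m" "D \<in> carrier_mat m m"
    "similar_mat A (four_block_mat (mat2 0 s 1 t) Y (0\<^sub>m m 2) D)"
proof -
  let ?n = "2 + m"
  obtain v s t where v: "v \<in> carrier_vec ?n" "\<And>c. A *\<^sub>v v \<noteq> c \<cdot>\<^sub>v v"
    and st: "A *\<^sub>v (A *\<^sub>v v) = s \<cdot>\<^sub>v v + t \<cdot>\<^sub>v (A *\<^sub>v v)"
    using quadratic_vec[OF A ns] by blast
  have v0: "v \<noteq> 0\<^sub>v ?n"
  proof
    assume v0: "v = 0\<^sub>v ?n"
    have "A *\<^sub>v v = 0 \<cdot>\<^sub>v v" unfolding v0 using A by (intro eq_vecI) (auto simp: scalar_prod_def)
    then show False using v(2) by blast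
  qed
  have Av: "A *\<^sub>v v \<in> carrier_vec ?n" using A v by auto
  obtain B where B: "B \<in> carrier_mat ?n ?n" "similar_mat A B"
    and c: "\<And>a b. A *\<^sub>v v = a \<cdot>\<^sub>v v + b \<cdot>\<^sub>v (A *\<^sub>v v) \<Longrightarrow> col B 0 = a \<cdot>\<^sub>v unit_vec ?n 0 + b \<cdot>\<^sub>v unit_vec ?n 1"
    "\<And>a b. A *\<^sub>v (A *\<^sub>v v) = a \<cdot>\<^sub>v v + b \<cdot>\<^sub>v (A *\<^sub>v v) \<Longrightarrow> col B 1 = a \<cdot>\<^sub>v unit_vec ?n 0 + b \<cdot>\<^sub>v unit_vec ?n 1"
    using similar_mat_adapted_basis[OF A _ v(1) v0 Av v(2)] by (metis le_add1)
  have "A *\<^sub>v v = 0 \<cdot>\<^sub>v v + 1 \<cdot>\<^sub>v (A *\<^sub>v v)" using A v(1) by (intro eq_vecI) auto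
  note c0 = c(1)[OF this] and c1 = c(2)[OF st]
  have B0: "B $$ (i,0) = (if i = 1 then 1 else 0)" if "i < ?n" for i
    using arg_cong[OF c0, of "\<lambda>v. v $ i"] that B(1) by auto
  have B1: "B $$ (i,1) = (if i = 0 then s else if i = 1 then t else 0)" if "i < ?n" for i
    using arg_cong[OF c1, of "\<lambda>v. v $ i"] that B(1) by auto
  define Y where "Y = mat 2 m (\<lambda>(i,j). B $$ (i, j + 2))"
  define D where "D = mat m m (\<lambda>(i,j). B $$ (i + 2, j + 2))"
  have "B = four_block_mat (mat2 0 s 1 t) Y (0\<^sub>m m 2) D"
  proof (rule eq_matI)
    fix i j assume "i < dim_row (four_block_mat (mat2 0 s 1 t) Y (0\<^sub>m m 2) D)"
      "j < dim_col (four_block_mat (mat2 0 s 1 t) Y (0\<^sub>m m 2) D)"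
    then have ij: "i < ?n" "j < ?n" by (auto simp: D_def mat2_def)
    consider "j = 0" | "j = 1" | "j \<ge> 2" by linarith
    then show "B $$ (i,j) = four_block_mat (mat2 0 s 1 t) Y (0\<^sub>m m 2) D $$ (i,j)"
    proof cases
      case 1 then show ?thesis using ij B0[OF ij(1)] by (auto simp: mat2_def D_def)
    next
      case 2 then show ?thesis using ij B1[OF ij(1)] by (auto simp: mat2_def D_def)
    next
      case 3
      then have "Suc (Suc (j - 2)) = j" "\<not> i < 2 \<Longrightarrow> Suc (Suc (i - 2)) = i" by auto
      then show ?thesis using ij 3 by (auto simp: mat2_def D_def Y_def)
    qed
  qed (use B in \<open>auto simp: D_def mat2_def\<close>)
  then show thesis using that[of Y D s t] B by (simp add: Y_def D_def)
qed

section \<open>Block matrices\<close>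

declare similar_mat_trans [trans]

text \<open>Conjugation by the block permutation matrix. It exchanges lower and upper triangular
  shapes and later moves the support of a diagonal matrix.\<close>

lemma similar_mat_swap_blocks:
  fixes A :: "'a::field mat"
  assumes A: "A \<in> carrier_mat n n" and B: "B \<in> carrier_mat n m"
    and C: "C \<in> carrier_mat m n" and D: "D \<in> carrier_mat m m"
  shows "similar_mat (four_block_mat A B C D) (four_block_mat D C B A)"
proof -
  let ?P = "four_block_mat (0\<^sub>m n m) (1\<^sub>m n) (1\<^sub>m m) (0\<^sub>m m n) :: 'a mat"
  let ?Q = "four_block_mat (0\<^sub>m m n) (1\<^sub>m m) (1\<^sub>m n) (0\<^sub>m n m) :: 'a mat"
  have P: "?P \<in> carrier_mat (n + m) (m + n)" and Q: "?Q \<in> carrier_mat (m + n) (n + m)" by auto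
  have PQ: "?P * ?Q = 1\<^sub>m (n + m)"
    by (subst mult_four_block_mat[of _ n m _ n _ m _ _ n _ m]) auto
  have QP: "?Q * ?P = 1\<^sub>m (n + m)"
    by (subst mult_four_block_mat[of _ m n _ m _ n _ _ m _ n]) (auto simp: add.commute)
  have "?P * four_block_mat D C B A = four_block_mat B A D C"
    by (subst mult_four_block_mat[of _ n m _ n _ m _ _ m _ n]) (use A B C D in auto)
  also have "\<dots> * ?Q = four_block_mat A B C D"
    by (subst mult_four_block_mat[of _ n m _ n _ m _ _ n _ m]) (use A B C D in auto)
  finally have "four_block_mat A B C D = ?P * four_block_mat D C B A * ?Q" by simp
  then show ?thesis
    using A D P Q by (intro similar_matI[OF _ PQ QP]) (auto simp: add.commute)
qed

lemma four_block_mat_diag: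
  "four_block_mat (mat_diag n f) (0\<^sub>m n m) (0\<^sub>m m n) (mat_diag m g)
    = mat_diag (n + m) (\<lambda>i. if i < n then f i else g (i - n))"
  by (rule eq_matI) (auto simp: mat_diag_def)

text \<open>Conjugation by a unipotent block matrix with corner \<open>W\<close> clears
  \<open>Y\<close> when \<open>W\<close> solves a Sylvester equation; between diagonal matrices
  without common entries that equation is solved entry by entry.\<close>

lemma similar_mat_decouple:
  fixes f g :: "nat \<Rightarrow> 'a::field"
  assumes Y: "Y \<in> carrier_mat n m" and fg: "\<And>i j. i < n \<Longrightarrow> j < m \<Longrightarrow> f i \<noteq> g j"
  shows "similar_mat (four_block_mat (mat_diag n f) Y (0\<^sub>m m n) (mat_diag m g))
           (four_block_mat (mat_diag n f) (0\<^sub>m n m) (0\<^sub>m m n) (mat_diag m g))"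
proof -
  \<comment> \<open>The entry \<open>(i,j)\<close> of the Sylvester equation reads
    \<open>f i * w + y = w * g j\<close>.\<close>
  define W where "W = mat n m (\<lambda>(i,j). Y $$ (i,j) / (g j - f i))"
  have W: "W \<in> carrier_mat n m" unfolding W_def by simp
  let ?P = "four_block_mat (1\<^sub>m n) W (0\<^sub>m m n) (1\<^sub>m m)"
  note mult_diag = right_mult_one_mat[OF mat_diag_dim] left_mult_one_mat[OF mat_diag_dim]
    right_mult_zero_mat[OF mat_diag_dim] left_mult_zero_mat[OF mat_diag_dim]
    right_add_zero_mat[OF mat_diag_dim] left_add_zero_mat[OF mat_diag_dim]
  have "mat_diag n f * W + Y = W * mat_diag m g"
  proof (rule eq_matI)
    fix i j assume "i < dim_row (W * mat_diag m g)" "j < dim_col (W * mat_diag m g)"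
    then have ij: "i < n" "j < m" using W by (auto simp: mat_diag_def)
    have "f i * y / (g j - f i) + y = y * g j / (g j - f i)" for y
      using fg[OF ij] by (simp add: field_simps)
    then show "(mat_diag n f * W + Y) $$ (i,j) = (W * mat_diag m g) $$ (i,j)"
      using ij Y unfolding mat_diag_mult_left[OF W] mat_diag_mult_right[OF W] by (simp add: W_def)
  qed (use W Y in \<open>auto simp: mat_diag_def\<close>)
  moreover have "four_block_mat (mat_diag n f) Y (0\<^sub>m m n) (mat_diag m g) * ?P =
     four_block_mat (mat_diag n f) (mat_diag n f * W + Y) (0\<^sub>m m n) (mat_diag m g)"
    by (subst mult_four_block_mat[of _ n n _ m _ m _ _ n _ m]) (use Y W in \<open>auto simp: mult_diag\<close>)
  moreover have "?P * four_block_mat (mat_diag n f) (0\<^sub>m n m) (0\<^sub>m m n) (mat_diag m g) =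
     four_block_mat (mat_diag n f) (W * mat_diag m g) (0\<^sub>m m n) (mat_diag m g)"
    by (subst mult_four_block_mat[of _ n n _ m _ m _ _ n _ m]) (use Y W in \<open>auto simp: mult_diag\<close>)
  moreover have "det ?P = 1"
    by (subst det_four_block_mat_lower_left_zero[of _ n _ m]) (use W in auto)
  ultimately show ?thesis
    by (intro similar_matI_intertwine[of _ "n + m" _ ?P]) auto
qed

lemma similar_mat_upper_block_diag:
  fixes X :: "'a::field mat"
  assumes X: "X \<in> carrier_mat n n" "similar_mat X (mat_diag n f)"
    and Z: "Z \<in> carrier_mat m m" "similar_mat Z (mat_diag m g)"
    and Y: "Y \<in> carrier_mat n m" and fg: "\<And>i j. i < n \<Longrightarrow> j < m \<Longrightarrow> f i \<noteq> g j"
  shows "similar_mat (four_block_mat X Y (0\<^sub>m m n) Z)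
           (mat_diag (n + m) (\<lambda>i. if i < n then f i else g (i - n)))"
proof -
  obtain Y' where "Y' \<in> carrier_mat n m"
    "similar_mat (four_block_mat X Y (0\<^sub>m m n) Z) (four_block_mat (mat_diag n f) Y' (0\<^sub>m m n) (mat_diag m g))"
    using similar_mat_four_block_0_ex[OF X(2) Z(2) Y X(1) Z(1)] by blast
  then show ?thesis
    using similar_mat_trans similar_mat_decouple[of Y' n m f g] fg unfolding four_block_mat_diag by blast
qed

text \<open>Swapping the blocks reduces to the upper triangular case; a second swap restores the
  order of the diagonal.\<close>

lemma similar_mat_lower_block_diag:
  fixes X :: "'a::field mat"
  assumes X: "X \<in> carrier_mat n n" "similar_mat X (mat_diag n f)"
    and Z: "Z \<in> carrier_mat m m" "similar_mat Z (mat_diag m g)"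
    and Y: "Y \<in> carrier_mat m n" and fg: "\<And>i j. i < n \<Longrightarrow> j < m \<Longrightarrow> f i \<noteq> g j"
  shows "similar_mat (four_block_mat X (0\<^sub>m n m) Y Z)
           (mat_diag (n + m) (\<lambda>i. if i < n then f i else g (i - n)))"
proof -
  have "similar_mat (four_block_mat X (0\<^sub>m n m) Y Z) (four_block_mat Z Y (0\<^sub>m n m) X)"
    using similar_mat_swap_blocks[OF X(1) _ Y Z(1)] by simp
  also have "similar_mat (four_block_mat Z Y (0\<^sub>m n m) X)
      (four_block_mat (mat_diag m g) (0\<^sub>m m n) (0\<^sub>m n m) (mat_diag n f))"
    unfolding four_block_mat_diag
    by (rule similar_mat_upper_block_diag[OF Z X Y]) (metis fg)
  also have "similar_mat \<dots>
      (four_block_mat (mat_diag n f) (0\<^sub>m n m) (0\<^sub>m m n) (mat_diag m g))"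
    by (rule similar_mat_swap_blocks) auto
  finally show ?thesis unfolding four_block_mat_diag .
qed

lemma right_inverse_mat_unique:
  fixes A :: "'a::field mat"
  assumes A: "A \<in> carrier_mat n n" and X: "X \<in> carrier_mat n n" "A * X = 1\<^sub>m n"
    and Y: "Y \<in> carrier_mat n n" "A * Y = 1\<^sub>m n"
  shows "X = Y"
proof -
  have "X * A = 1\<^sub>m n" using mat_mult_left_right_inverse[OF A X] .
  then show ?thesis using assoc_mult_mat[OF X(1) A Y(1)] X Y by simp
qed

lemma similar_mat_inverse:
  fixes A :: "'a::field mat"
  assumes A: "A \<in> carrier_mat n n" and Ai: "Ai \<in> carrier_mat n n" "A * Ai = 1\<^sub>m n"
    and Bi: "Bi \<in> carrier_mat n n" "B * Bi = 1\<^sub>m n" and AB: "similar_mat A B"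
  shows "similar_mat Ai Bi"
proof -
  obtain P Q where w: "similar_mat_wit A B P Q" using AB unfolding similar_mat_def by blast
  note d = similar_mat_witD2[OF A w]
  note a = assoc_mult_mat[of _ n n _ n _ n]
  have "A * (P * Bi * Q) = P * B * (Q * P) * Bi * Q" unfolding d(3) using d(5-7) Bi(1) by (simp add: a)
  also have "\<dots> = P * (B * Bi) * Q" using d(2,5-7) Bi(1) by (simp add: a)
  also have "\<dots> = 1\<^sub>m n" using d(1,6,7) Bi by simp
  finally have "Ai = P * Bi * Q"
    using d(6,7) Bi(1) by (intro right_inverse_mat_unique[OF A Ai]) auto
  then show ?thesis using d(1,2,6,7) Ai Bi by (intro similar_matI[of _ _ P Q n]) auto
qed

section \<open>Companion matrices of size 2\<close>

lemma mat2_mult: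
  "mat2 a b c d * mat2 a' b' c' d' =
     mat2 (a * a' + b * c') (a * b' + b * d') (c * a' + d * c') (c * b' + d * (d' :: 'a :: semiring_0))"
proof (rule eq_matI)
  fix i j assume ij: "i < dim_row (mat2 (a * a' + b * c') (a * b' + b * d') (c * a' + d * c') (c * b' + d * d'))"
    "j < dim_col (mat2 (a * a' + b * c') (a * b' + b * d') (c * a' + d * c') (c * b' + d * d'))"
  then have "i = 0 \<or> i = 1" "j = 0 \<or> j = 1" by (auto simp: mat2_def)
  then show "(mat2 a b c d * mat2 a' b' c' d') $$ (i,j) =
     mat2 (a * a' + b * c') (a * b' + b * d') (c * a' + d * c') (c * b' + d * d') $$ (i,j)"
    by (auto simp: mat2_def scalar_prod_def numeral_2_eq_2)
qed (auto simp: mat2_def)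

lemma one_mat2: "1\<^sub>m 2 = mat2 1 0 0 1"
  by (rule eq_matI) (auto simp: mat2_def)

text \<open>Conjugating the inverse companion matrix by \<open>diag(1, x)\<close> multiplies its
  off-diagonal entries by \<open>1 / x\<close> and \<open>x\<close>. Its product with the companion
  matrix is then lower triangular with diagonal \<open>x, 1 / x\<close>, whatever \<open>s\<close>
  and \<open>t\<close> are.\<close>

lemma companion_pair:
  fixes s t x :: "'a::field"
  assumes s: "s \<noteq> 0" and x: "x \<noteq> 0" "x \<noteq> 1 / x"
  obtains Ci b where "Ci \<in> carrier_mat 2 2" "mat2 0 s 1 t * Ci = 1\<^sub>m 2"
    "similar_mat b Ci" "similar_mat (mat2 0 s 1 t * b) (mat_diag 2 (\<lambda>i. if i = 0 then x else 1 / x))"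
proof -
  define Ci where "Ci = mat2 (- t / s) 1 (1 / s) 0"
  define b where "b = mat2 (- t / s) (1 / x) (x / s) 0"
  have 1: "mat2 0 s 1 t * Ci = 1\<^sub>m 2"
    unfolding Ci_def mat2_mult one_mat2 using s by simp
  have 2: "similar_mat b Ci"
    by (rule similar_matI[of _ _ "mat2 1 0 0 x" "mat2 1 0 0 (1 / x)" 2])
      (use x in \<open>auto simp: b_def Ci_def mat2_mult one_mat2\<close>)
  define y where "y = - t / s + t * (x / s)"
  \<comment> \<open>Chosen so that conjugation by the unitriangular matrix with entry
    \<open>p\<close> produces the corner \<open>p * (x - 1 / x) = y\<close>; here
    \<open>x \<noteq> 1 / x\<close> is used.\<close>
  define p where "p = y / (x - 1 / x)"
  have d: "mat_diag 2 (\<lambda>i. if i = 0 then x else 1 / x) = mat2 x 0 0 (1 / x)"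
    by (rule eq_matI) (auto simp: mat_diag_def mat2_def)
  have C: "mat2 0 s 1 t * b = mat2 x 0 y (1 / x)"
    unfolding b_def mat2_mult y_def using s by simp
  have p: "p * (x - 1 / x) = y" unfolding p_def using x by simp
  have "y = p * x + - (p * (1 / x))" unfolding p[symmetric] by (simp add: algebra_simps)
  then have 3: "similar_mat (mat2 0 s 1 t * b) (mat_diag 2 (\<lambda>i. if i = 0 then x else 1 / x))"
    unfolding d C
    by (intro similar_matI[of _ _ "mat2 1 0 p 1" "mat2 1 0 (-p) 1" 2])
      (auto simp: mat2_mult one_mat2)
  show thesis by (rule that[OF _ 1 2 3]) (simp add: Ci_def)
qed

text \<open>Truncated subtraction makes the values 1 from index \<open>2 * d\<close> on.\<close>

definition reciprocal_powers :: "nat \<Rightarrow> nat \<Rightarrow> real" where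
  "reciprocal_powers d i = (if even i then 2 ^ (d - i div 2) else 1 / 2 ^ (d - i div 2))"

section \<open>A pair of conjugates that is diagonalizable\<close>

lemma reciprocal_powers_pos: "reciprocal_powers d i > 0" unfolding reciprocal_powers_def by simp

lemma reciprocal_powers_0: "reciprocal_powers 0 i = 1" unfolding reciprocal_powers_def by simp

lemma reciprocal_powers_Suc: "reciprocal_powers (Suc d) (Suc (Suc i)) = reciprocal_powers d i" unfolding reciprocal_powers_def by simp

text \<open>Separates the values in use from the pair \<open>2 ^ Suc d\<close>,
  \<open>1 / 2 ^ Suc d\<close> contributed by the next plane.\<close>

lemma reciprocal_powers_bounds: "reciprocal_powers d i \<le> 2 ^ d" "1 / 2 ^ d \<le> reciprocal_powers d i"
proof -
  have a: "(2::real) ^ (d - k) \<le> 2 ^ d" for k by (auto intro: power_increasing)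
  have b: "(1::real) \<le> 2 ^ k" "1 / (2::real) ^ k \<le> 1" for k by auto
  have c: "1 / (2::real) ^ d \<le> 1 / 2 ^ (d - k)" for k using a[of k] by (auto simp: field_simps)
  show "reciprocal_powers d i \<le> 2 ^ d"
    using a[of "i div 2"] order_trans[OF b(2)[of "d - i div 2"] b(1)[of d]] unfolding reciprocal_powers_def by auto
  show "1 / 2 ^ d \<le> reciprocal_powers d i"
    using order_trans[OF b(2)[of d] b(1)[of "d - i div 2"]] c[of "i div 2"] unfolding reciprocal_powers_def by auto
qed

lemma mult_four_block_upper:
  fixes A :: "'a::semiring_1 mat"
  assumes "A \<in> carrier_mat n n" "Y \<in> carrier_mat n m" "D \<in> carrier_mat m m"
    "A' \<in> carrier_mat n n" "Y' \<in> carrier_mat n m" "D' \<in> carrier_mat m m"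
  shows "four_block_mat A Y (0\<^sub>m m n) D * four_block_mat A' Y' (0\<^sub>m m n) D' =
    four_block_mat (A * A') (A * Y' + Y * D') (0\<^sub>m m n) (D * D')"
  by (subst mult_four_block_mat[of _ n n _ m _ m _ _ n _ m]) (use assms in auto)

lemma four_block_upper_inverse:
  fixes C :: "'a::field mat"
  assumes C: "C \<in> carrier_mat n n" and Ci: "Ci \<in> carrier_mat n n" "C * Ci = 1\<^sub>m n"
    and D: "D \<in> carrier_mat m m" and Di: "Di \<in> carrier_mat m m" "D * Di = 1\<^sub>m m"
    and Y: "Y \<in> carrier_mat n m"
  shows "four_block_mat C Y (0\<^sub>m m n) D * four_block_mat Ci (- (Ci * (Y * Di))) (0\<^sub>m m n) Di = 1\<^sub>m (n + m)"
proof -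
  have "C * - (Ci * (Y * Di)) = - (Y * Di)"
    using C Ci Y Di(1) assoc_mult_mat[OF C Ci(1), of "Y * Di" m]
    by (subst uminus_mult_right_mat) auto
  moreover have "- (Y * Di) + Y * Di = 0\<^sub>m n m"
    using Y Di(1) by (intro uminus_l_inv_mat) auto
  moreover have "- (Ci * (Y * Di)) \<in> carrier_mat n m" using Ci Y Di by auto
  ultimately show ?thesis
    by (simp only: mult_four_block_upper[OF C Y D Ci(1) _ Di(1)] Ci(2) Di(2) four_block_one_mat)
qed

text \<open>Diagonal blocks can be replaced by conjugates at the price of an uncontrolled corner,
  which \<open>similar_mat_decouple\<close> removes afterwards.\<close>

lemma similar_mat_blocks_upper_ex:
  fixes A :: "'a::field mat"
  assumes "similar_mat A A'" "similar_mat D D'" "Y \<in> carrier_mat n m" "A \<in> carrier_mat n n" "D \<in> carrier_mat m m"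
  obtains Y' where "Y' \<in> carrier_mat n m"
    "similar_mat (four_block_mat A' Y' (0\<^sub>m m n) D') (four_block_mat A Y (0\<^sub>m m n) D)"
  using similar_mat_four_block_0_ex[OF assms] similar_mat_sym by blast

lemma mult_eq_one_det_nz:
  fixes A :: "'a::field mat"
  assumes "A \<in> carrier_mat n n" "B \<in> carrier_mat n n" "A * B = 1\<^sub>m n"
  shows "det A \<noteq> 0"
  using det_mult[OF assms(1,2)] assms(3) by auto

text \<open>Strong induction, splitting off one companion block at a time. The rank bound for
  \<open>g - l\<close> is carried as a factorization \<open>U * V\<close> because that form extends
  blockwise. Once the rest is scalar, \<open>g * gi = 1\<close> supplies the entries 1.\<close>

lemma conj_pair_diag:
  fixes g gi :: "complex mat"
  assumes "g \<in> carrier_mat n n" "gi \<in> carrier_mat n n" "g * gi = 1\<^sub>m n"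
  shows "\<exists>d l U V a b. 2 * d \<le> n \<and> l \<noteq> 0 \<and> U \<in> carrier_mat n (2 * d) \<and> V \<in> carrier_mat (2 * d) n \<and>
    g - l \<cdot>\<^sub>m 1\<^sub>m n = U * V \<and> similar_mat a g \<and> similar_mat b gi \<and>
    similar_mat (a * b) (mat_diag n (\<lambda>i. complex_of_real (reciprocal_powers d i)))"
  using assms
proof (induction n arbitrary: g gi rule: less_induct)
  case (less n g gi)
  note g = less.prems(1) and gi = less.prems(2,3)
  show ?case
  proof (cases "\<exists>c. g = c \<cdot>\<^sub>m 1\<^sub>m n")
    case True
    then obtain c where c: "g = c \<cdot>\<^sub>m 1\<^sub>m n" by blast
    \<comment> \<open>In size 0 the equation for \<open>c\<close> also holds with
      \<open>c = 0\<close>, hence the separate value.\<close>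
    define l where "l = (if n = 0 then 1 else c)"
    have gl: "g = l \<cdot>\<^sub>m 1\<^sub>m n" unfolding l_def c by (auto intro: eq_matI)
    have "l \<noteq> 0"
    proof
      assume "l = 0"
      then have "c = 0" "n > 0" unfolding l_def by (auto split: if_splits)
      then show False using mult_eq_one_det_nz[OF g gi] c by auto
    qed
    moreover have "g - l \<cdot>\<^sub>m 1\<^sub>m n = 0\<^sub>m n 0 * 0\<^sub>m 0 n" using gl by (auto intro!: eq_matI simp: scalar_prod_def)
    moreover have "similar_mat (g * gi) (mat_diag n (\<lambda>i. complex_of_real (reciprocal_powers 0 i)))"
      unfolding gi(2) using similar_mat_refl[of "1\<^sub>m n" n] by (simp add: reciprocal_powers_0)
    ultimately show ?thesis
      using similar_mat_refl[OF g] similar_mat_refl[OF gi(1)]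
      by (intro exI[of _ 0] exI[of _ l] exI[of _ "0\<^sub>m n 0"] exI[of _ "0\<^sub>m 0 n"] exI[of _ g] exI[of _ gi]) simp
  next
    case False
    then have ns: "\<And>c. g \<noteq> c \<cdot>\<^sub>m 1\<^sub>m n" by blast
    have "n \<noteq> 0" using ns[of 0] g by (auto intro!: eq_matI)
    moreover have "n \<noteq> 1" using ns[of "g $$ (0,0)"] g by (auto intro!: eq_matI)
    ultimately have "2 \<le> n" by linarith
    then obtain m where n: "n = 2 + m" using le_Suc_ex by blast
    obtain s t Y D where Y: "Y \<in> carrier_mat 2 m" and D: "D \<in> carrier_mat m m"
      and sim: "similar_mat g (four_block_mat (mat2 0 s 1 t) Y (0\<^sub>m m 2) D)"
      using similar_mat_companion_block[OF g[unfolded n] ns[unfolded n]] .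
    define C where "C = mat2 0 s 1 t"
    define B where "B = four_block_mat C Y (0\<^sub>m m 2) D"
    have C: "C \<in> carrier_mat 2 2" unfolding C_def by simp
    have B: "B \<in> carrier_mat n n" unfolding B_def n by (rule four_block_carrier_mat[OF C D])
    have gB: "similar_mat g B" using sim unfolding B_def C_def .
    have "det B \<noteq> 0" using mult_eq_one_det_nz[OF g gi] det_similar[OF gB] by simp
    moreover have "det B = det C * det D"
      unfolding B_def by (rule det_four_block_mat_lower_left_zero[OF C Y refl D])
    ultimately have dC: "det C \<noteq> 0" and dD: "det D \<noteq> 0" by auto
    have s0: "s \<noteq> 0"
    proof
      assume s: "s = 0"
      obtain Q where Q: "Q \<in> carrier_mat 2 2" "C * Q = 1\<^sub>m 2" using obtain_inverse_mat[OF C dC] .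
      have "(C * Q) $$ (0,0) = 0" using s Q(1) unfolding C_def mat2_def by (simp add: scalar_prod_def)
      then show False using Q by simp
    qed
    obtain Di where Di: "Di \<in> carrier_mat m m" "D * Di = 1\<^sub>m m" using obtain_inverse_mat[OF D dD] .
    obtain d l U V a b where IH: "2 * d \<le> m" "l \<noteq> 0" "U \<in> carrier_mat m (2 * d)" "V \<in> carrier_mat (2 * d) m"
      "D - l \<cdot>\<^sub>m 1\<^sub>m m = U * V" "similar_mat a D" "similar_mat b Di"
      "similar_mat (a * b) (mat_diag m (\<lambda>i. complex_of_real (reciprocal_powers d i)))"
      using less.IH[OF _ D Di] n by auto
    have ab: "a \<in> carrier_mat m m" "b \<in> carrier_mat m m"
      using similar_mat_carrier[OF similar_mat_sym[OF IH(6)] D] similar_mat_carrier[OF similar_mat_sym[OF IH(7)] Di(1)] .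
    \<comment> \<open>Larger than every value used for \<open>D\<close>, with inverse smaller than
      each of them: the spectra of the two diagonal blocks are disjoint.\<close>
    define x where "x = complex_of_real (2 ^ Suc d)"
    have x: "x \<noteq> 0" unfolding x_def by simp
    have px: "reciprocal_powers d i < 2 ^ Suc d" "1 / 2 ^ Suc d < reciprocal_powers d i" for i
    proof -
      have "(2::real) ^ d < 2 ^ Suc d" by simp
      then show "reciprocal_powers d i < 2 ^ Suc d" using reciprocal_powers_bounds(1)[of d i] by linarith
      have "1 / (2::real) ^ Suc d < 1 / 2 ^ d" by (simp add: field_simps)
      then show "1 / 2 ^ Suc d < reciprocal_powers d i" using reciprocal_powers_bounds(2)[of d i] by linarith
    qed
    have "(2::real) ^ Suc d \<noteq> 1 / 2 ^ Suc d" using px[of 0] by linarith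
    moreover have ix: "1 / x = complex_of_real (1 / 2 ^ Suc d)" unfolding x_def by simp
    ultimately have x1: "x \<noteq> 1 / x" unfolding ix unfolding x_def of_real_eq_iff by blast
    obtain Ci e where Ci: "Ci \<in> carrier_mat 2 2" "C * Ci = 1\<^sub>m 2" and e: "similar_mat e Ci"
      "similar_mat (C * e) (mat_diag 2 (\<lambda>i. if i = 0 then x else 1 / x))"
      using companion_pair[OF s0 x x1, of t] unfolding C_def by blast
    have ec: "e \<in> carrier_mat 2 2" using similar_mat_carrier[OF similar_mat_sym[OF e(1)] Ci(1)] .
    define Z where "Z = - (Ci * (Y * Di))"
    have Z: "Z \<in> carrier_mat 2 m" unfolding Z_def using Ci Y Di by auto
    define Bi where "Bi = four_block_mat Ci Z (0\<^sub>m m 2) Di"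
    have Bi: "Bi \<in> carrier_mat n n" "B * Bi = 1\<^sub>m n"
      using four_block_upper_inverse[OF C Ci D Di Y] Ci Di unfolding Bi_def B_def Z_def n by auto
    have giBi: "similar_mat gi Bi" using similar_mat_inverse[OF g gi Bi gB] .
    obtain Y' where Y': "Y' \<in> carrier_mat 2 m" "similar_mat (four_block_mat C Y' (0\<^sub>m m 2) a) B"
      using similar_mat_blocks_upper_ex[OF similar_mat_refl[OF C] similar_mat_sym[OF IH(6)] Y C D]
      unfolding B_def by blast
    obtain Z' where Z': "Z' \<in> carrier_mat 2 m" "similar_mat (four_block_mat e Z' (0\<^sub>m m 2) b) Bi"
      using similar_mat_blocks_upper_ex[OF similar_mat_sym[OF e(1)] similar_mat_sym[OF IH(7)] Z Ci(1) Di(1)]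
      unfolding Bi_def by blast
    have "similar_mat (four_block_mat (C * e) (C * Z' + Y' * b) (0\<^sub>m m 2) (a * b))
      (mat_diag (2 + m) (\<lambda>i. if i < 2 then (if i = 0 then x else 1 / x) else complex_of_real (reciprocal_powers d (i - 2))))"
    proof (rule similar_mat_upper_block_diag[OF _ e(2) _ IH(8)])
      fix i j :: nat
      have "2 ^ Suc d \<noteq> reciprocal_powers d j" "1 / 2 ^ Suc d \<noteq> reciprocal_powers d j" using px[of j] by linarith+
      then show "(if i = 0 then x else 1 / x) \<noteq> complex_of_real (reciprocal_powers d j)"
        unfolding ix unfolding x_def by (simp only: of_real_eq_iff split: if_split) blast
    qed (use C ec ab Y'(1) Z'(1) in auto)
    also have "(\<lambda>i. if i < 2 then (if i = 0 then x else 1 / x) else complex_of_real (reciprocal_powers d (i - 2)))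
      = (\<lambda>i. complex_of_real (reciprocal_powers (Suc d) i))"
    proof
      fix i :: nat
      consider "i = 0" | "i = 1" | j where "i = Suc (Suc j)"
        by (metis One_nat_def nat.exhaust)
      then show "(if i < 2 then (if i = 0 then x else 1 / x) else complex_of_real (reciprocal_powers d (i - 2)))
        = complex_of_real (reciprocal_powers (Suc d) i)"
        by cases (simp_all add: x_def reciprocal_powers_Suc, simp_all add: reciprocal_powers_def)
    qed
    finally have P: "similar_mat (four_block_mat C Y' (0\<^sub>m m 2) a * four_block_mat e Z' (0\<^sub>m m 2) b)
        (mat_diag n (\<lambda>i. complex_of_real (reciprocal_powers (Suc d) i)))"
      unfolding mult_four_block_upper[OF C Y'(1) ab(1) ec Z'(1) ab(2)] n .
    obtain R S where w: "similar_mat_wit g B R S" using gB unfolding similar_mat_def by blast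
    note rs = similar_mat_witD2[OF g w]
    \<comment> \<open>The two top rows of \<open>B - l\<close> are kept whole in \<open>V'\<close>,
      and only the lower block is factored; the inner dimension grows by 2.\<close>
    define U' where "U' = four_block_mat (1\<^sub>m 2) (0\<^sub>m 2 (2 * d)) (0\<^sub>m m 2) U"
    define V' where "V' = four_block_mat (C - l \<cdot>\<^sub>m 1\<^sub>m 2) Y (0\<^sub>m (2 * d) 2) V"
    have U': "U' \<in> carrier_mat n (2 * Suc d)" using four_block_carrier_mat[OF one_carrier_mat[of 2] IH(3)] unfolding U'_def n by simp
    have V': "V' \<in> carrier_mat (2 * Suc d) n" using IH(4) C unfolding V'_def n by auto
    have "B - l \<cdot>\<^sub>m 1\<^sub>m n = four_block_mat (C - l \<cdot>\<^sub>m 1\<^sub>m 2) Y (0\<^sub>m m 2) (D - l \<cdot>\<^sub>m 1\<^sub>m m)"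
      unfolding B_def n using C Y D by (intro eq_matI) auto
    also have "\<dots> = U' * V'" unfolding U'_def V'_def
      unfolding IH(5) by (subst mult_four_block_mat[of _ 2 2 _ "2 * d" _ m _ _ 2 _ m])
        (use IH(3,4) C Y in auto)
    finally have "g - l \<cdot>\<^sub>m 1\<^sub>m n = R * (U' * V') * S"
      using similar_minus_scalar[OF g w, of l] by simp
    also have "\<dots> = (R * U') * (V' * S)"
      using assoc_mult_mat[OF rs(6) U' V'] assoc_mult_mat[OF mult_carrier_mat[OF rs(6) U'] V' rs(7)] by simp
    finally have "g - l \<cdot>\<^sub>m 1\<^sub>m n = (R * U') * (V' * S)" .
    moreover have "R * U' \<in> carrier_mat n (2 * Suc d)" "V' * S \<in> carrier_mat (2 * Suc d) n"
      using U' V' rs by auto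
    moreover have "2 * Suc d \<le> n" using IH(1) n by simp
    moreover have "similar_mat (four_block_mat C Y' (0\<^sub>m m 2) a) g"
      using Y'(2) similar_mat_sym[OF gB] by (rule similar_mat_trans)
    moreover have "similar_mat (four_block_mat e Z' (0\<^sub>m m 2) b) gi"
      using Z'(2) similar_mat_sym[OF giBi] by (rule similar_mat_trans)
    ultimately show ?thesis using IH(2) P by blast
  qed
qed

section \<open>Factorization into diagonalizable matrices\<close>

text \<open>Meant for matrices with first column \<open>(1, 1, 0, \<dots>, 0)\<close>, whose Schur complement with respect to
  entry \<open>(0, 0)\<close> only changes the first row of the lower right block.\<close>

definition schur_complement :: "nat \<Rightarrow> 'a::ring_1 mat \<Rightarrow> 'a mat" where
  "schur_complement m B = mat m m (\<lambda>(i,j). B $$ (Suc i, Suc j) - (if i = 0 then B $$ (0, Suc j) else 0))"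

lemma schur_complement_carrier[simp]: "schur_complement m B \<in> carrier_mat m m"
  unfolding schur_complement_def by simp

lemma smult_smult_mat: "a \<cdot>\<^sub>m (b \<cdot>\<^sub>m A) = (a * b) \<cdot>\<^sub>m (A :: 'a::semigroup_mult mat)"
  by (rule eq_matI) (auto simp: mult.assoc)

text \<open>Block elimination with pivot 1. Splitting the pivot as \<open>x * (1 / x)\<close>
  prescribes one eigenvalue of each triangular factor; the others come from the factorization of the
  complement.\<close>

lemma schur_complement_factorization:
  fixes B :: "'a::field mat"
  assumes B: "B \<in> carrier_mat (1 + m) (1 + m)"
    and c0: "\<And>i. i < 1 + m \<Longrightarrow> B $$ (i,0) = (if i \<le> 1 then 1 else 0)"
    and R: "R \<in> carrier_mat m m" and S: "S \<in> carrier_mat m m" "schur_complement m B = R * S"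
    and x: "x \<noteq> 0"
  defines "e \<equiv> mat m 1 (\<lambda>(i,j). if i = 0 then 1 else 0)" and "y \<equiv> mat 1 m (\<lambda>(i,j). B $$ (0, Suc j))"
  shows "B = four_block_mat (x \<cdot>\<^sub>m 1\<^sub>m 1) (0\<^sub>m 1 m) (x \<cdot>\<^sub>m e) R
           * four_block_mat ((1 / x) \<cdot>\<^sub>m 1\<^sub>m 1) ((1 / x) \<cdot>\<^sub>m y) (0\<^sub>m m 1) S"
proof -
  have e: "e \<in> carrier_mat m 1" and y: "y \<in> carrier_mat 1 m" unfolding e_def y_def by auto
  have one11: "c \<cdot>\<^sub>m 1\<^sub>m 1 * N = c \<cdot>\<^sub>m N" if "N \<in> carrier_mat 1 k" for N :: "'a mat" and c k
    using mult_smult_assoc_mat[OF one_carrier_mat that, of c] that by simp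
  have smult1: "1 \<cdot>\<^sub>m N = N" for N :: "'a mat" by (rule eq_matI) auto
  have "four_block_mat (x \<cdot>\<^sub>m 1\<^sub>m 1) (0\<^sub>m 1 m) (x \<cdot>\<^sub>m e) R
           * four_block_mat ((1 / x) \<cdot>\<^sub>m 1\<^sub>m 1) ((1 / x) \<cdot>\<^sub>m y) (0\<^sub>m m 1) S
     = four_block_mat (1\<^sub>m 1) y e (e * y + R * S)"
    using e y R S(1) x one11[OF smult_carrier_mat[OF y]] one11[OF smult_carrier_mat[OF one_carrier_mat]]
      mult_smult_distrib[OF e y] mult_smult_assoc_mat[OF e y]
      mult_smult_distrib[OF e one_carrier_mat[of 1]] mult_smult_assoc_mat[OF e one_carrier_mat]
      mult_smult_assoc_mat[OF e smult_carrier_mat[OF y]] mult_smult_assoc_mat[OF e smult_carrier_mat[OF one_carrier_mat]]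
    by (subst mult_four_block_mat[of _ 1 1 _ m _ m _ _ 1 _ m]) (auto simp: smult_smult_mat smult1)
  also have "\<dots> = B"
  proof (rule eq_matI)
    fix i j assume "i < dim_row B" "j < dim_col B"
    then have ij: "i < 1 + m" "j < 1 + m" using B by auto
    have ey: "(e * y) $$ (k,l) = (if k = 0 then B $$ (0, Suc l) else 0)" if "k < m" "l < m" for k l
      using that by (auto simp: e_def y_def scalar_prod_def)
    show "four_block_mat (1\<^sub>m 1) y e (e * y + R * S) $$ (i,j) = B $$ (i,j)"
    proof (cases j)
      case 0
      then show ?thesis using ij c0[OF ij(1)] e R S(1) y by (auto simp: e_def)
    next
      case (Suc l)
      then show ?thesis using ij y e R S ey[of "i - 1" l]
        unfolding S(2)[symmetric] by (cases i) (auto simp: schur_complement_def y_def)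
    qed
  qed (use B R S e y in auto)
  finally show ?thesis by simp
qed

text \<open>The block elimination with \<open>x = 1\<close> and left block
  \<open>1\<^sub>m m\<close> has a left factor of determinant 1.\<close>

lemma det_schur_complement:
  fixes B :: "'a::field mat"
  assumes B: "B \<in> carrier_mat (1 + m) (1 + m)"
    and c0: "\<And>i. i < 1 + m \<Longrightarrow> B $$ (i,0) = (if i \<le> 1 then 1 else 0)"
  shows "det (schur_complement m B) = det B"
proof -
  let ?e = "mat m 1 (\<lambda>(i,j). if i = 0 then 1 else 0) :: 'a mat"
  let ?y = "mat 1 m (\<lambda>(i,j). B $$ (0, Suc j))"
  let ?S = "schur_complement m B"
  have "B = four_block_mat (1 \<cdot>\<^sub>m 1\<^sub>m 1) (0\<^sub>m 1 m) (1 \<cdot>\<^sub>m ?e) (1\<^sub>m m)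
           * four_block_mat ((1 / 1) \<cdot>\<^sub>m 1\<^sub>m 1) ((1 / 1) \<cdot>\<^sub>m ?y) (0\<^sub>m m 1) ?S"
    by (rule schur_complement_factorization[OF B c0]) (auto simp: left_mult_one_mat[OF schur_complement_carrier])
  also have "det \<dots> = det (four_block_mat (1 \<cdot>\<^sub>m 1\<^sub>m 1) (0\<^sub>m 1 m) (1 \<cdot>\<^sub>m ?e) (1\<^sub>m m))
     * det (four_block_mat ((1 / 1) \<cdot>\<^sub>m 1\<^sub>m 1) ((1 / 1) \<cdot>\<^sub>m ?y) (0\<^sub>m m 1) ?S)"
    by (rule det_mult; rule four_block_carrier_mat) auto
  also have "\<dots> = det ?S"
    by (subst det_four_block_mat_upper_right_zero[of _ 1 _ m], simp_all)
      (subst det_four_block_mat_lower_left_zero[of _ 1 _ m], simp_all)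
  finally show ?thesis by simp
qed

text \<open>If the Schur complement happens to be a scalar \<open>c\<close>, then the conjugation adding column 0 to
  column 2 puts \<open>c \<noteq> 0\<close> off its diagonal.\<close>

lemma nonscalar_similar_schur:
  fixes A :: "'a::field mat"
  assumes A: "A \<in> carrier_mat (1 + m) (1 + m)" and det: "det A = 1"
    and ns: "\<And>c. A \<noteq> c \<cdot>\<^sub>m 1\<^sub>m (1 + m)"
  obtains B where "B \<in> carrier_mat (1 + m) (1 + m)" "similar_mat A B"
    "\<And>i. i < 1 + m \<Longrightarrow> B $$ (i,0) = (if i \<le> 1 then 1 else 0)"
    "schur_complement m B = 1\<^sub>m m \<or> (\<forall>c. schur_complement m B \<noteq> c \<cdot>\<^sub>m 1\<^sub>m m)"
proof -
  let ?n = "1 + m"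
  have m: "m \<noteq> 0"
  proof
    assume "m = 0"
    then have "A = (A $$ (0,0)) \<cdot>\<^sub>m 1\<^sub>m ?n" using A by (auto intro!: eq_matI)
    then show False using ns by blast
  qed
  obtain v where v: "v \<in> carrier_vec ?n" and Av: "\<And>c. A *\<^sub>v v \<noteq> c \<cdot>\<^sub>v v"
    using nonscalar_moves_vec[OF A ns] by blast
  have v0: "v \<noteq> 0\<^sub>v ?n"
  proof
    assume v0: "v = 0\<^sub>v ?n"
    have "A *\<^sub>v v = 0 \<cdot>\<^sub>v v" unfolding v0 using A by (intro eq_vecI) (auto simp: scalar_prod_def)
    then show False using Av by blast
  qed
  \<comment> \<open>With this second basis vector \<open>A v = v + w\<close>, so the first column
    becomes \<open>(1, 1, 0, ...)\<close> and the pivot is 1.\<close>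
  define w where "w = A *\<^sub>v v - v"
  have Avc: "A *\<^sub>v v \<in> carrier_vec ?n" using A v by auto
  have w: "w \<in> carrier_vec ?n" using Avc v unfolding w_def by auto
  have Avw: "A *\<^sub>v v = 1 \<cdot>\<^sub>v v + 1 \<cdot>\<^sub>v w" using A Avc v unfolding w_def by (intro eq_vecI) auto
  have wv: "w \<noteq> c \<cdot>\<^sub>v v" for c
  proof
    assume "w = c \<cdot>\<^sub>v v"
    then have "A *\<^sub>v v = (1 + c) \<cdot>\<^sub>v v" unfolding Avw using v by (intro eq_vecI) (auto simp: algebra_simps)
    then show False using Av by blast
  qed
  have n2: "2 \<le> ?n" using m by simp
  obtain B where B: "B \<in> carrier_mat ?n ?n" "similar_mat A B"
    and c': "\<And>a b. A *\<^sub>v v = a \<cdot>\<^sub>v v + b \<cdot>\<^sub>v w \<Longrightarrow> col B 0 = a \<cdot>\<^sub>v unit_vec ?n 0 + b \<cdot>\<^sub>v unit_vec ?n 1"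
    by (rule similar_mat_adapted_basis[OF A n2 v v0 w wv]) (rule that)
  note c = c'[OF Avw]
  have B0: "B $$ (i,0) = (if i \<le> 1 then 1 else 0)" if "i < ?n" for i
    using arg_cong[OF c, of "\<lambda>v. v $ i"] that B(1) m by auto
  have dS: "det (schur_complement m B) = 1"
    using det_schur_complement[OF B(1) B0] det_similar[OF B(2)] det by simp
  show thesis
  proof (cases "schur_complement m B = 1\<^sub>m m \<or> (\<forall>c. schur_complement m B \<noteq> c \<cdot>\<^sub>m 1\<^sub>m m)")
    case True
    then show thesis using that[OF B B0] by blast
  next
    case False
    then obtain c where c: "schur_complement m B = c \<cdot>\<^sub>m 1\<^sub>m m" "schur_complement m B \<noteq> 1\<^sub>m m" by blast
    have c1: "c ^ m = 1" using dS unfolding c(1) by simp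
    then have c0: "c \<noteq> 0" using m by (cases m) auto
    \<comment> \<open>In size 1 the determinant gives \<open>c = 1\<close>, and the complement would
      be the identity.\<close>
    have "m \<noteq> 1" using c c1 by auto
    then have m2: "m \<ge> 2" using m by simp
    \<comment> \<open>The conjugation also subtracts row 2 from row 0; as
      \<open>B $$ (2,0) = 0\<close>, the first column is preserved.\<close>
    define B' where "B' = add_col_sub_row 1 0 2 B"
    have B': "B' \<in> carrier_mat ?n ?n" unfolding B'_def using B by auto
    have "similar_mat B' B" unfolding B'_def using B(1) m2 by (intro add_col_sub_row_similar) auto
    then have sim: "similar_mat A B'" using B(2) similar_mat_sym similar_mat_trans by blast
    have B'0: "B' $$ (i,0) = (if i \<le> 1 then 1 else 0)" if "i < ?n" for i
      using that B(1) B0[OF that] B0[of 2] m2 unfolding B'_def by auto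
    have s01: "B $$ (1,2) - B $$ (0,2) = 0"
      using arg_cong[OF c(1), of "\<lambda>M. M $$ (0,1)"] m2 by (simp add: schur_complement_def numeral_2_eq_2)
    have s11: "B $$ (2,2) = c"
      using arg_cong[OF c(1), of "\<lambda>M. M $$ (1,1)"] m2 by (simp add: schur_complement_def numeral_2_eq_2)
    have "schur_complement m B' $$ (0,1) = B' $$ (1,2) - B' $$ (0,2)"
      using m2 by (simp add: schur_complement_def numeral_2_eq_2)
    also have "\<dots> = c"
      using m2 B(1) s01 s11 B0[of 0] B0[of 1] B0[of 2] unfolding B'_def by simp
    finally have "schur_complement m B' \<noteq> d \<cdot>\<^sub>m 1\<^sub>m m" for d using c0 m2 by auto
    then show thesis using that[OF B' sim B'0] by blast
  qed
qed

lemma sourour_factorization: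
  fixes A :: "'a::field mat"
  assumes "A \<in> carrier_mat n n" "det A = 1" "A = 1\<^sub>m n \<or> (\<forall>c. A \<noteq> c \<cdot>\<^sub>m 1\<^sub>m n)"
    and "inj_on f {..<n}" "\<And>i. i < n \<Longrightarrow> f i \<noteq> 0"
  shows "\<exists>B C. A = B * C \<and> similar_mat B (mat_diag n f) \<and> similar_mat C (mat_diag n (\<lambda>i. 1 / f i))"
  using assms
proof (induction n arbitrary: A f)
  case 0
  have "A = 1\<^sub>m 0 * 1\<^sub>m 0" using 0(1) by (intro eq_matI) auto
  moreover have "mat_diag 0 g = 1\<^sub>m 0" for g :: "nat \<Rightarrow> 'a" by (rule eq_matI) (auto simp: mat_diag_def)
  ultimately show ?case
    using similar_mat_refl[OF one_carrier_mat[of 0]] by (intro exI[of _ "1\<^sub>m 0"]) simp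
next
  case (Suc m)
  show ?case
  proof (cases "A = 1\<^sub>m (Suc m)")
    case True
    have "A = mat_diag (Suc m) f * mat_diag (Suc m) (\<lambda>i. 1 / f i)"
      unfolding True mat_diag_diag using Suc.prems(5) by (intro eq_matI) (auto simp: mat_diag_def)
    then show ?thesis using similar_mat_refl mat_diag_dim by blast
  next
    case False
    then have ns: "\<And>c. A \<noteq> c \<cdot>\<^sub>m 1\<^sub>m (1 + m)" and A: "A \<in> carrier_mat (1 + m) (1 + m)"
      using Suc.prems(1,3) by auto
    obtain B where B: "B \<in> carrier_mat (1 + m) (1 + m)" "similar_mat A B"
      and B0: "\<And>i. i < 1 + m \<Longrightarrow> B $$ (i,0) = (if i \<le> 1 then 1 else 0)"
      and S: "schur_complement m B = 1\<^sub>m m \<or> (\<forall>c. schur_complement m B \<noteq> c \<cdot>\<^sub>m 1\<^sub>m m)"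
      by (rule nonscalar_similar_schur[OF A Suc.prems(2) ns]) (rule that)
    have dS: "det (schur_complement m B) = 1"
      using det_schur_complement[OF B(1) B0] det_similar[OF B(2)] Suc.prems(2) by simp
    have inj: "inj_on (\<lambda>i. f (Suc i)) {..<m}"
      using Suc.prems(4) by (auto simp: inj_on_def)
    obtain R T where RT: "schur_complement m B = R * T" "similar_mat R (mat_diag m (\<lambda>i. f (Suc i)))"
      "similar_mat T (mat_diag m (\<lambda>i. 1 / f (Suc i)))"
      using Suc.IH[OF schur_complement_carrier dS S inj] Suc.prems(5) by auto
    have R: "R \<in> carrier_mat m m" and T: "T \<in> carrier_mat m m"
      using similar_mat_carrier[OF similar_mat_sym[OF RT(2)] mat_diag_dim]
        similar_mat_carrier[OF similar_mat_sym[OF RT(3)] mat_diag_dim] .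
    have f0: "f 0 \<noteq> 0" using Suc.prems(5) by simp
    have f0S: "f 0 \<noteq> f (Suc j)" if "j < m" for j
      using inj_onD[OF Suc.prems(4), of 0 "Suc j"] that by auto
    define e :: "'a mat" where "e = mat m 1 (\<lambda>(i,j). if i = 0 then 1 else 0)"
    define y where "y = mat 1 m (\<lambda>(i,j). B $$ (0, Suc j))"
    define L where "L = four_block_mat (f 0 \<cdot>\<^sub>m 1\<^sub>m 1) (0\<^sub>m 1 m) (f 0 \<cdot>\<^sub>m e) R"
    define V where "V = four_block_mat ((1 / f 0) \<cdot>\<^sub>m 1\<^sub>m 1) ((1 / f 0) \<cdot>\<^sub>m y) (0\<^sub>m m 1) T"
    have BLV: "B = L * V" unfolding L_def V_def e_def y_def
      by (rule schur_complement_factorization[OF B(1) B0 R T RT(1) f0])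
    have d1: "c \<cdot>\<^sub>m 1\<^sub>m 1 = mat_diag 1 (\<lambda>i. c)" for c :: 'a
      by (rule eq_matI) (auto simp: mat_diag_def)
    have shift: "(\<lambda>i. if i < 1 then g 0 else g (Suc (i - 1))) = g" for g :: "nat \<Rightarrow> 'a"
    proof
      fix i show "(if i < 1 then g 0 else g (Suc (i - 1))) = g i" by (cases i) auto
    qed
    have L: "similar_mat L (mat_diag (1 + m) f)"
      unfolding L_def d1
      using similar_mat_lower_block_diag[OF mat_diag_dim similar_mat_refl[OF mat_diag_dim] R RT(2), of "f 0 \<cdot>\<^sub>m e" 1 "\<lambda>i. f 0"]
        f0S shift[of f] by (simp add: e_def)
    have V: "similar_mat V (mat_diag (1 + m) (\<lambda>i. 1 / f i))"
      unfolding V_def d1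
      using similar_mat_upper_block_diag[OF mat_diag_dim similar_mat_refl[OF mat_diag_dim] T RT(3), of "(1 / f 0) \<cdot>\<^sub>m y" 1 "\<lambda>i. 1 / f 0"]
        f0S shift[of "\<lambda>i. 1 / f i"] by (simp add: y_def)
    obtain P Q where w: "similar_mat_wit A B P Q" using B(2) unfolding similar_mat_def by blast
    note d = similar_mat_witD2[OF A w]
    have LV: "L \<in> carrier_mat (1 + m) (1 + m)" "V \<in> carrier_mat (1 + m) (1 + m)"
      unfolding L_def V_def using R T by auto
    note a = assoc_mult_mat[of _ "1 + m" "1 + m" _ "1 + m" _ "1 + m"]
    have 1: "(P * L * Q) * (P * V * Q) = P * L * (Q * P) * V * Q"
      using LV d(6,7) by (simp add: a)
    have 2: "P * L * (Q * P) * V * Q = P * (L * V) * Q"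
      unfolding d(2) using LV d(6,7) by (simp add: a)
    have 3: "P * (L * V) * Q = P * B * Q" by (subst BLV) (rule refl)
    have *: "A = (P * L * Q) * (P * V * Q)"
      by (rule trans[OF d(3) trans[OF 3[symmetric] trans[OF 2[symmetric] 1[symmetric]]]])
    have conj: "similar_mat (P * X * Q) X" if "X \<in> carrier_mat (1 + m) (1 + m)" for X
      using that d(6,7) by (intro similar_matI[OF _ d(1,2) refl]) auto
    have "similar_mat (P * L * Q) (mat_diag (Suc m) f)"
      using similar_mat_trans[OF conj[OF LV(1)] L] by simp
    moreover have "similar_mat (P * V * Q) (mat_diag (Suc m) (\<lambda>i. 1 / f i))"
      using similar_mat_trans[OF conj[OF LV(2)] V] by simp
    ultimately show ?thesis using * by blast
  qed
qed

section \<open>Products of conjugates in the special linear group\<close>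

text \<open>Similarity permits any invertible conjugating matrix; rescaling to determinant 1 is
  postponed. When \<open>gi\<close> inverts \<open>g\<close>, counting in pairs makes these sets
  increase with the index, as \<open>g * gi\<close> is a pair with product 1.\<close>

fun conj_products :: "nat \<Rightarrow> 'a::semiring_1 mat \<Rightarrow> 'a mat \<Rightarrow> nat \<Rightarrow> 'a mat set" where
  "conj_products n g gi 0 = {1\<^sub>m n}"
| "conj_products n g gi (Suc k) =
     {a * b * h | a b h. similar_mat a g \<and> similar_mat b gi \<and> h \<in> conj_products n g gi k}"

text \<open>Below \<open>2 * d\<close> the even indices carry values above 1 and the odd ones values
  below 1, and within each parity the exponents differ.\<close>

lemma reciprocal_powers_inj: "inj_on (reciprocal_powers d) {..<2 * d}"
proof (rule inj_onI)
  fix i j assume ij: "i \<in> {..<2 * d}" "j \<in> {..<2 * d}" and eq: "reciprocal_powers d i = reciprocal_powers d j"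
  have k: "i div 2 < d" "j div 2 < d" using ij by auto
  have gt: "reciprocal_powers d k > 1 \<longleftrightarrow> even k" if "k < 2 * d" for k
  proof -
    have "k div 2 < d" using that by auto
    then have "1 < (2::real) ^ (d - k div 2)" by (auto intro: one_less_power)
    then show ?thesis unfolding reciprocal_powers_def by auto
  qed
  have par: "even i \<longleftrightarrow> even j" using gt[of i] gt[of j] ij eq by simp
  then have "(2::real) ^ (d - i div 2) = 2 ^ (d - j div 2)"
    using eq unfolding reciprocal_powers_def by (auto split: if_splits)
  then have "d - i div 2 = d - j div 2" by (simp add: power_inject_exp)
  then have "i div 2 = j div 2" using k by linarith
  then show "i = j" using par by (metis div_mult_mod_eq even_iff_mod_2_eq_zero not_mod_2_eq_1_eq_0)
qed

lemma reciprocal_powers_ge: "2 * d \<le> i \<Longrightarrow> reciprocal_powers d i = 1"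
  unfolding reciprocal_powers_def by (auto simp: div_le_mono)

lemma det_mat_diag: "det (mat_diag p f) = (\<Prod>i<p. f i)"
  for f :: "nat \<Rightarrow> 'a::comm_ring_1"
  by (subst det_upper_triangular[of _ p])
    (auto simp: mat_diag_def diag_mat_def prod.list_conv_set_nth upper_triangular_def lessThan_atLeast0 intro!: prod.cong)

text \<open>Distinct powers of 2 above 1, with the inverse of their product, at most 1, as the last
  entry.\<close>

lemma obtain_distinct_pos_prod_one:
  assumes "n \<ge> 1"
  obtains f :: "nat \<Rightarrow> real" where "\<And>i. f i > 0" "\<And>i. n \<le> i \<Longrightarrow> f i = 1" "(\<Prod>i<n. f i) = 1" "inj_on f {..<n}"
proof -
  define c where "c = (\<Prod>i<n - 1. (2::real) ^ Suc i)"
  define f where "f = (\<lambda>i. if i < n - 1 then (2::real) ^ Suc i else if i = n - 1 then 1 / c else 1)"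
  have n: "Suc (n - 1) = n" using assms by simp
  have "1 \<le> (\<Prod>i<n - 1. (2::real) ^ Suc i)" by (intro prod_ge_1 one_le_power) simp
  then have c: "c \<ge> 1" unfolding c_def .
  have pos: "f i > 0" for i unfolding f_def using c by auto
  have "(\<Prod>i<n. f i) = (\<Prod>i<n - 1. f i) * f (n - 1)"
    using prod.lessThan_Suc[of f "n - 1"] unfolding n .
  also have "(\<Prod>i<n - 1. f i) = c" unfolding c_def by (intro prod.cong) (auto simp: f_def)
  finally have prod: "(\<Prod>i<n. f i) = 1" using c unfolding f_def by simp
  have ge: "f i = 1" if "n \<le> i" for i using that n unfolding f_def by auto
  have big: "1 < (2::real) ^ Suc i" for i by (rule one_less_power) auto
  have small: "1 / c \<le> 1" using c by simp
  have "inj_on f {..<n}"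
  proof (rule inj_onI)
    fix i j assume ij: "i \<in> {..<n}" "j \<in> {..<n}" and eq: "f i = f j"
    have "i < n - 1 \<or> i = n - 1" "j < n - 1 \<or> j = n - 1" using ij by auto
    then show "i = j" using eq big[of i] big[of j] small power_inject_exp[of "2::real" "Suc i" "Suc j"]
      unfolding f_def by (auto split: if_splits simp del: power_Suc)
  qed
  then show thesis using that[of f] pos ge prod by blast
qed

context
  fixes n :: nat and g gi :: "complex mat"
  assumes g: "g \<in> carrier_mat n n" and gi: "gi \<in> carrier_mat n n" and inv: "g * gi = 1\<^sub>m n"
begin

section \<open>Closure properties of products of conjugate pairs\<close>

lemma conj_carrier:
  "similar_mat a g \<Longrightarrow> a \<in> carrier_mat n n" "similar_mat b gi \<Longrightarrow> b \<in> carrier_mat n n"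
  using similar_mat_carrier[OF similar_mat_sym g] similar_mat_carrier[OF similar_mat_sym gi] by auto

lemma conj_products_carrier: "h \<in> conj_products n g gi k \<Longrightarrow> h \<in> carrier_mat n n"
  by (induction k arbitrary: h) (auto intro!: mult_carrier_mat dest: conj_carrier)

lemma conj_products_mult: "h \<in> conj_products n g gi k \<Longrightarrow> h' \<in> conj_products n g gi l \<Longrightarrow> h * h' \<in> conj_products n g gi (k + l)"
proof (induction k arbitrary: h)
  case 0
  then show ?case using left_mult_one_mat[OF conj_products_carrier[OF 0(2)]] by simp
next
  case (Suc k)
  then obtain a b x where x: "similar_mat a g" "similar_mat b gi" "x \<in> conj_products n g gi k" "h = a * b * x" by auto
  have "a * b \<in> carrier_mat n n" using conj_carrier x by (metis mult_carrier_mat)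
  then have "h * h' = a * b * (x * h')" unfolding x(4)
    using assoc_mult_mat[OF _ conj_products_carrier[OF x(3)] conj_products_carrier[OF Suc.prems(2)]] by blast
  then show ?case using Suc.IH[OF x(3) Suc.prems(2)] x by auto
qed

lemma conj_products_similar: "h \<in> conj_products n g gi k \<Longrightarrow> similar_mat h' h \<Longrightarrow> h' \<in> conj_products n g gi k"
proof (induction k arbitrary: h h')
  case 0
  then obtain P Q where w: "similar_mat_wit h' (1\<^sub>m n) P Q" unfolding similar_mat_def by auto
  have "h' \<in> carrier_mat n n" using similar_mat_carrier[OF similar_mat_sym[OF 0(2)]] 0(1) by simp
  note d = similar_mat_witD2[OF this w]
  have "h' = 1\<^sub>m n" using d(1,3) right_mult_one_mat[OF d(6)] by simp
  then show ?case by simp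
next
  case (Suc k)
  then obtain a b x where x: "similar_mat a g" "similar_mat b gi" "x \<in> conj_products n g gi k" "h = a * b * x" by auto
  obtain P Q where w: "similar_mat_wit h' h P Q" using Suc.prems unfolding similar_mat_def by auto
  have "h' \<in> carrier_mat n n"
    using similar_mat_carrier[OF similar_mat_sym[OF Suc.prems(2)] conj_products_carrier[OF Suc.prems(1)]] .
  note d = similar_mat_witD2[OF this w]
  have abx: "a \<in> carrier_mat n n" "b \<in> carrier_mat n n" "x \<in> carrier_mat n n"
    using x conj_carrier conj_products_carrier by auto
  note assoc = assoc_mult_mat[of _ n n _ n _ n]
  have "(P * a * Q) * (P * b * Q) * (P * x * Q) = P * a * (Q * P) * b * (Q * P) * x * Q"
    using abx d(6,7) by (simp add: assoc)
  also have "\<dots> = h'" unfolding d(2) d(3) x(4) using abx d(6,7) by (simp add: assoc)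
  finally have h': "h' = (P * a * Q) * (P * b * Q) * (P * x * Q)" by simp
  have conj: "similar_mat (P * X * Q) X" if "X \<in> carrier_mat n n" for X
    using that d(6,7) by (intro similar_matI[OF _ d(1,2) refl]) auto
  have "similar_mat (P * a * Q) g" "similar_mat (P * b * Q) gi"
    using similar_mat_trans[OF conj[OF abx(1)] x(1)] similar_mat_trans[OF conj[OF abx(2)] x(2)] .
  moreover have "P * x * Q \<in> conj_products n g gi k" using Suc.IH[OF x(3) conj[OF abx(3)]] .
  ultimately show ?case unfolding h' by auto
qed

lemma conj_products_pair:
  assumes "similar_mat a g" "similar_mat b gi"
  shows "a * b \<in> conj_products n g gi 1"
proof -
  have "a * b \<in> carrier_mat n n" using conj_carrier assms by (metis mult_carrier_mat)
  then have "a * b = a * b * 1\<^sub>m n" by (rule right_mult_one_mat[symmetric])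
  then show ?thesis using assms by auto
qed

lemma conj_products_one: "1\<^sub>m n \<in> conj_products n g gi k"
proof (induction k)
  case (Suc k)
  have "1\<^sub>m n = g * gi * 1\<^sub>m n" unfolding inv by simp
  then show ?case using Suc similar_mat_refl[OF g] similar_mat_refl[OF gi] by auto
qed simp

lemma conj_products_mono: "h \<in> conj_products n g gi k \<Longrightarrow> k \<le> l \<Longrightarrow> h \<in> conj_products n g gi l"
  using conj_products_mult[OF _ conj_products_one[of "l - k"], of h k]
    right_mult_one_mat[OF conj_products_carrier, of h k] by simp

text \<open>Inverting \<open>a * b\<close> swaps the two factors and also exchanges the roles of
  \<open>g\<close> and \<open>gi\<close>, so the result is again a pair.\<close>

lemma conj_products_inverse:
  assumes s: "s \<in> conj_products n g gi 1" and si: "si \<in> carrier_mat n n" "s * si = 1\<^sub>m n"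
  shows "si \<in> conj_products n g gi 1"
proof -
  obtain a b where ab: "similar_mat a g" "similar_mat b gi" "s = a * b * 1\<^sub>m n" using s by auto
  have c: "a \<in> carrier_mat n n" "b \<in> carrier_mat n n" using ab conj_carrier by auto
  have inv': "gi * g = 1\<^sub>m n" using mat_mult_left_right_inverse[OF g gi inv] .
  have "det a \<noteq> 0" "det b \<noteq> 0"
    using mult_eq_one_det_nz[OF g gi inv] mult_eq_one_det_nz[OF gi g inv'] det_similar ab by metis+
  then obtain ai bi where i: "ai \<in> carrier_mat n n" "a * ai = 1\<^sub>m n" "bi \<in> carrier_mat n n" "b * bi = 1\<^sub>m n"
    using obtain_inverse_mat[OF c(1)] obtain_inverse_mat[OF c(2)] by metis
  have sim: "similar_mat ai gi" "similar_mat bi g"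
    using similar_mat_inverse[OF c(1) i(1,2) gi inv ab(1)] similar_mat_inverse[OF c(2) i(3,4) g inv' ab(2)] .
  note assoc = assoc_mult_mat[of _ n n _ n _ n]
  have sc: "s \<in> carrier_mat n n" using conj_products_carrier[OF s] .
  have "s * (bi * ai) = a * (b * bi) * ai" unfolding ab(3) using c i(1,3) by (simp add: assoc)
  also have "\<dots> = 1\<^sub>m n" unfolding i(4) right_mult_one_mat[OF c(1)] by (rule i(2))
  finally have "si = bi * ai" using right_inverse_mat_unique[OF sc si, of "bi * ai"] i(1,3) by auto
  then show ?thesis using conj_products_pair[OF sim(2,1)] by simp
qed

text \<open>In size \<open>2 * d\<close> Sourour's factors are prescribed to have the nontrivial
  entries of the available diagonal matrix and their inverses. Extended by an identity block they
  are similar to that matrix and to its inverse, at one pair each.\<close>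

lemma conj_products_block:
  assumes d: "2 * d \<le> n" and s: "mat_diag n (\<lambda>i. complex_of_real (reciprocal_powers d i)) \<in> conj_products n g gi 1"
    and h: "h \<in> carrier_mat (2 * d) (2 * d)" "det h = 1" "h = 1\<^sub>m (2 * d) \<or> (\<forall>c. h \<noteq> c \<cdot>\<^sub>m 1\<^sub>m (2 * d))"
  shows "four_block_mat h (0\<^sub>m (2 * d) (n - 2 * d)) (0\<^sub>m (n - 2 * d) (2 * d)) (1\<^sub>m (n - 2 * d)) \<in> conj_products n g gi 2"
proof -
  define p where "p = 2 * d"
  define u where "u = n - p"
  have n: "n = p + u" using d unfolding p_def u_def by simp
  let ?f = "\<lambda>i. complex_of_real (reciprocal_powers d i)"
  let ?b = "\<lambda>h. four_block_mat h (0\<^sub>m p u) (0\<^sub>m u p) (1\<^sub>m u)"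
  have f0: "?f i \<noteq> 0" for i using reciprocal_powers_pos[of d i] by simp
  have inj: "inj_on ?f {..<p}" using reciprocal_powers_inj[of d] unfolding p_def inj_on_def by simp
  obtain B C where BC: "h = B * C" "similar_mat B (mat_diag p ?f)" "similar_mat C (mat_diag p (\<lambda>i. 1 / ?f i))"
    using sourour_factorization[OF h(1,2,3)[folded p_def] inj f0] by blast
  have B: "B \<in> carrier_mat p p" and C: "C \<in> carrier_mat p p"
    using similar_mat_carrier[OF similar_mat_sym[OF BC(2)] mat_diag_dim]
      similar_mat_carrier[OF similar_mat_sym[OF BC(3)] mat_diag_dim] .
  have eq: "?b h = ?b B * ?b C" unfolding BC(1)
    by (subst mult_four_block_upper[where n = p and m = u]) (use B C in auto)
  have block: "?b (mat_diag p k) = mat_diag n k" if "\<And>i. p \<le> i \<Longrightarrow> k i = 1" for k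
    unfolding n using that by (intro eq_matI) (auto simp: mat_diag_def)
  have "similar_mat (?b B) (mat_diag n ?f)"
    using similar_mat_four_block_0_0[OF BC(2) similar_mat_refl[OF one_carrier_mat[of u]] B one_carrier_mat]
      block[of ?f] reciprocal_powers_ge[of d] unfolding p_def by simp
  then have 1: "?b B \<in> conj_products n g gi 1" using conj_products_similar[OF s] by blast
  have "mat_diag n ?f * mat_diag n (\<lambda>i. 1 / ?f i) = 1\<^sub>m n"
    unfolding mat_diag_diag using f0 by (intro eq_matI) (auto simp: mat_diag_def)
  then have si: "mat_diag n (\<lambda>i. 1 / ?f i) \<in> conj_products n g gi 1"
    using conj_products_inverse[OF s mat_diag_dim] by blast
  have "similar_mat (?b C) (mat_diag n (\<lambda>i. 1 / ?f i))"
    using similar_mat_four_block_0_0[OF BC(3) similar_mat_refl[OF one_carrier_mat[of u]] C one_carrier_mat]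
      block[of "\<lambda>i. 1 / ?f i"] reciprocal_powers_ge[of d] unfolding p_def by simp
  then have 2: "?b C \<in> conj_products n g gi 1" using conj_products_similar[OF si] by blast
  have "?b h \<in> conj_products n g gi 2" unfolding eq using conj_products_mult[OF 1 2] by (simp add: numeral_2_eq_2)
  then show ?thesis unfolding p_def u_def .
qed

text \<open>Positivity excludes the bad scalars: a positive constant whose power is 1 equals
  1.\<close>

lemma conj_products_diag_short:
  assumes d: "2 * d \<le> n" "d \<ge> 1" and s: "mat_diag n (\<lambda>i. complex_of_real (reciprocal_powers d i)) \<in> conj_products n g gi 1"
    and f: "\<And>i. (f i :: real) > 0" "\<And>i. 2 * d \<le> i \<Longrightarrow> f i = 1" "(\<Prod>i<2*d. f i) = 1"
  shows "mat_diag n (\<lambda>i. complex_of_real (f i)) \<in> conj_products n g gi 2"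
proof -
  let ?h = "mat_diag (2 * d) (\<lambda>i. complex_of_real (f i))"
  have det: "det ?h = 1" unfolding det_mat_diag of_real_prod[symmetric] f(3) by simp
  have "?h = 1\<^sub>m (2 * d) \<or> (\<forall>c. ?h \<noteq> c \<cdot>\<^sub>m 1\<^sub>m (2 * d))"
  proof (rule disjCI)
    assume "\<not> (\<forall>c. ?h \<noteq> c \<cdot>\<^sub>m 1\<^sub>m (2 * d))"
    then obtain c where c: "?h = c \<cdot>\<^sub>m 1\<^sub>m (2 * d)" by blast
    have fc: "complex_of_real (f i) = c" if "i < 2 * d" for i
      using arg_cong[OF c, of "\<lambda>M. M $$ (i,i)"] that by (simp add: mat_diag_def)
    have fi: "f i = f 0" if "i < 2 * d" for i
    proof -
      have "complex_of_real (f i) = complex_of_real (f 0)" using fc[OF that] fc[of 0] d by simp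
      then show ?thesis by simp
    qed
    have "(\<Prod>i<2*d. f i) = (\<Prod>i<2*d. f 0)" by (rule prod.cong[OF refl], rule fi) simp
    then have "f 0 ^ (2 * d) = (\<Prod>i<2*d. f i)" by simp
    then have "f 0 = 1" using f(1)[of 0] f(3) d power_eq_imp_eq_base[of "f 0" "2 * d" 1] by auto
    then have "c = 1" using fc[of 0] d by simp
    then show "?h = 1\<^sub>m (2 * d)" unfolding c by (intro eq_matI) auto
  qed
  from conj_products_block[OF d(1) s mat_diag_dim det this]
  have "four_block_mat ?h (0\<^sub>m (2 * d) (n - 2 * d)) (0\<^sub>m (n - 2 * d) (2 * d)) (1\<^sub>m (n - 2 * d)) \<in> conj_products n g gi 2" .
  also have "four_block_mat ?h (0\<^sub>m (2 * d) (n - 2 * d)) (0\<^sub>m (n - 2 * d) (2 * d)) (1\<^sub>m (n - 2 * d))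
    = mat_diag n (\<lambda>i. complex_of_real (f i))"
    using d f(2) by (intro eq_matI) (auto simp: mat_diag_def)
  finally show ?thesis .
qed

text \<open>Each round costs two pairs and settles \<open>2 * d - 1\<close> positions. The factor
  \<open>f1\<close> copies \<open>f\<close> there and uses one more position to restore product 1;
  the remainder \<open>f2\<close> starts at that position and is moved to the front as
  \<open>f3\<close>.\<close>

lemma conj_products_diag:
  assumes d: "2 * d \<le> n" "d \<ge> 1" and s: "mat_diag n (\<lambda>i. complex_of_real (reciprocal_powers d i)) \<in> conj_products n g gi 1"
    and f: "\<And>i. (f i :: real) > 0" "\<And>i. q \<le> i \<Longrightarrow> f i = 1" "(\<Prod>i<q. f i) = 1"
    and q: "q \<le> n" "q \<le> K * (2 * d - 1) + 1"
  shows "mat_diag n (\<lambda>i. complex_of_real (f i)) \<in> conj_products n g gi (2 * K)"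
  using f q
proof (induction K arbitrary: f q)
  case 0
  \<comment> \<open>Here \<open>q \<le> 1\<close>, and the product condition settles the only
    possible exception.\<close>
  have "f i = 1" for i
  proof (cases "i = 0 \<and> q = 1")
    case True then show ?thesis using 0(3) by simp
  next
    case False then show ?thesis using 0(2)[of i] 0(5) by (cases "q = 0") auto
  qed
  then show ?case by simp
next
  case (Suc K)
  define p where "p = 2 * d"
  have p: "p \<ge> 2" "p \<le> n" using d unfolding p_def by auto
  show ?case
  proof (cases "q \<le> p")
    case True
    have "(\<Prod>i<p. f i) = (\<Prod>i<q. f i)"
      using True Suc.prems(2) by (intro prod.mono_neutral_right) auto
    then have "mat_diag n (\<lambda>i. complex_of_real (f i)) \<in> conj_products n g gi 2"
      using Suc.prems True by (intro conj_products_diag_short[OF d s]) (auto simp: p_def)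
    then show ?thesis by (rule conj_products_mono) simp
  next
    case False
    define c where "c = (\<Prod>i<p - 1. f i)"
    have c: "c > 0" unfolding c_def using Suc.prems(1) by (intro prod_pos) auto
    \<comment> \<open>The entry \<open>1 / c\<close> balances the determinant of \<open>f1\<close>;
      \<open>f2\<close> compensates with \<open>c * f i\<close> at the same position.\<close>
    define f1 where "f1 = (\<lambda>i. if i < p - 1 then f i else if i = p - 1 then 1 / c else 1)"
    define f2 where "f2 = (\<lambda>i. if i < p - 1 then 1 else if i = p - 1 then c * f i else f i)"
    define f3 where "f3 = (\<lambda>i. f2 (i + (p - 1)))"
    have Sp: "Suc (p - 1) = p" using p by simp
    have f: "f i = f1 i * f2 i" for i unfolding f1_def f2_def using c by auto
    have "(\<Prod>i<p. f1 i) = (\<Prod>i<p - 1. f1 i) * f1 (p - 1)"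
      using prod.lessThan_Suc[of f1 "p - 1"] unfolding Sp .
    also have "(\<Prod>i<p - 1. f1 i) = c" unfolding c_def by (intro prod.cong) (auto simp: f1_def)
    finally have "(\<Prod>i<p. f1 i) = 1" using c unfolding f1_def by simp
    then have 1: "mat_diag n (\<lambda>i. complex_of_real (f1 i)) \<in> conj_products n g gi 2"
      using Suc.prems(1) c p by (intro conj_products_diag_short[OF d s]) (auto simp: f1_def p_def)
    have f3q: "f3 i = 1" if "q - (p - 1) \<le> i" for i
      using that Suc.prems(2)[of "i + (p - 1)"] False unfolding f3_def f2_def by auto
    have "(\<Prod>i<q. f i) = (\<Prod>i<q. f1 i) * (\<Prod>i<q. f2 i)" unfolding f prod.distrib ..
    also have "(\<Prod>i<q. f1 i) = (\<Prod>i<p. f1 i)"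
      using False Sp by (intro prod.mono_neutral_right) (auto simp: f1_def)
    also have "(\<Prod>i<q. f2 i) = (\<Prod>i\<in>{p - 1..<q}. f2 i)"
      by (intro prod.mono_neutral_right) (auto simp: f2_def)
    also have "\<dots> = (\<Prod>i<q - (p - 1). f3 i)"
    proof -
      have "{p - 1..<q} = {0 + (p - 1)..<(q - (p - 1)) + (p - 1)}" using False by auto
      then show ?thesis unfolding f3_def lessThan_atLeast0
        using prod.shift_bounds_nat_ivl[of f2 0 "p - 1" "q - (p - 1)"] by simp
    qed
    finally have f3p: "(\<Prod>i<q - (p - 1). f3 i) = 1" using Suc.prems(3) \<open>(\<Prod>i<p. f1 i) = 1\<close> by simp
    have 3: "mat_diag n (\<lambda>i. complex_of_real (f3 i)) \<in> conj_products n g gi (2 * K)"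
    proof (rule Suc.IH[OF _ f3q f3p])
      show "f3 i > 0" for i unfolding f3_def f2_def using Suc.prems(1) c by auto
      show "q - (p - 1) \<le> n" using Suc.prems(4) by simp
      show "q - (p - 1) \<le> K * (2 * d - 1) + 1" using Suc.prems(5) unfolding p_def by simp
    qed
    define u where "u = p - 1"
    define t where "t = n - u"
    have n: "n = u + t" "n = t + u" unfolding u_def t_def using p by auto
    \<comment> \<open>The leading \<open>u\<close> ones of \<open>f2\<close> become trailing ones of
      \<open>f3\<close>, so the two diagonal matrices differ by a swap of blocks.\<close>
    have "mat_diag n (\<lambda>i. complex_of_real (f2 i)) =
       four_block_mat (1\<^sub>m u) (0\<^sub>m u t) (0\<^sub>m t u) (mat_diag t (\<lambda>i. complex_of_real (f3 i)))"
      unfolding n(1) by (intro eq_matI) (auto simp: mat_diag_def f3_def f2_def u_def)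
    moreover have "mat_diag n (\<lambda>i. complex_of_real (f3 i)) =
       four_block_mat (mat_diag t (\<lambda>i. complex_of_real (f3 i))) (0\<^sub>m t u) (0\<^sub>m u t) (1\<^sub>m u)"
    proof -
      have "f3 i = 1" if "t \<le> i" for i using f3q[of i] that Suc.prems(4) unfolding t_def u_def by simp
      then show ?thesis unfolding n(2) by (intro eq_matI) (auto simp: mat_diag_def)
    qed
    ultimately have "similar_mat (mat_diag n (\<lambda>i. complex_of_real (f2 i))) (mat_diag n (\<lambda>i. complex_of_real (f3 i)))"
      using similar_mat_swap_blocks[of "1\<^sub>m u" u "0\<^sub>m u t" t "0\<^sub>m t u" "mat_diag t (\<lambda>i. complex_of_real (f3 i))"] by simp
    then have 2: "mat_diag n (\<lambda>i. complex_of_real (f2 i)) \<in> conj_products n g gi (2 * K)"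
      using conj_products_similar[OF 3] by blast
    have "mat_diag n (\<lambda>i. complex_of_real (f i))
      = mat_diag n (\<lambda>i. complex_of_real (f1 i)) * mat_diag n (\<lambda>i. complex_of_real (f2 i))"
      unfolding mat_diag_diag f of_real_mult ..
    then show ?thesis using conj_products_mult[OF 1 2] by simp
  qed
qed

text \<open>Once distinct entries fill the diagonal, Sourour's factorization applies in full size.
  Its factors are similar to the diagonal matrices of \<open>f\<close> and \<open>1 / f\<close>,
  each costing \<open>2 * K\<close> pairs.\<close>

lemma conj_products_nonscalar:
  assumes d: "2 * d \<le> n" "d \<ge> 1" and s: "mat_diag n (\<lambda>i. complex_of_real (reciprocal_powers d i)) \<in> conj_products n g gi 1"
    and K: "n \<le> K * (2 * d - 1) + 1"
    and h: "h \<in> carrier_mat n n" "det h = 1" "\<And>c. h \<noteq> c \<cdot>\<^sub>m 1\<^sub>m n"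
  shows "h \<in> conj_products n g gi (4 * K)"
proof -
  obtain f :: "nat \<Rightarrow> real" where pos: "\<And>i. f i > 0" and ge: "\<And>i. n \<le> i \<Longrightarrow> f i = 1"
    and prod: "(\<Prod>i<n. f i) = 1" and inj: "inj_on f {..<n}"
    by (rule obtain_distinct_pos_prod_one[of n]) (use d in simp, rule that)
  have 1: "mat_diag n (\<lambda>i. complex_of_real (f i)) \<in> conj_products n g gi (2 * K)"
    by (rule conj_products_diag[OF d s pos ge prod order_refl K])
  have 2: "mat_diag n (\<lambda>i. complex_of_real (1 / f i)) \<in> conj_products n g gi (2 * K)"
    by (rule conj_products_diag[OF d s _ _ _ order_refl K]) (use pos ge prod in \<open>auto simp: prod_dividef\<close>)
  have inj: "inj_on (\<lambda>i. complex_of_real (f i)) {..<n}" using inj by (auto simp: inj_on_def)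
  have f0: "complex_of_real (f i) \<noteq> 0" for i using pos[of i] by simp
  obtain B C where BC: "h = B * C" "similar_mat B (mat_diag n (\<lambda>i. complex_of_real (f i)))"
    "similar_mat C (mat_diag n (\<lambda>i. 1 / complex_of_real (f i)))"
    using sourour_factorization[OF h(1,2) _ inj f0] h(3) by blast
  have "B \<in> conj_products n g gi (2 * K)" using conj_products_similar[OF 1 BC(2)] .
  moreover have "C \<in> conj_products n g gi (2 * K)" using conj_products_similar[OF 2] BC(3) by simp
  ultimately have "h \<in> conj_products n g gi (2 * K + 2 * K)" unfolding BC(1) by (rule conj_products_mult)
  then show ?thesis by simp
qed

end

section \<open>The Jordan length\<close>

lemma rank_le_dim:
  fixes A :: "'a::field mat"
  assumes "A \<in> carrier_mat n n"
  shows "vec_space.rank n A \<le> n"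
  using vec_space.rank_le_nc[OF assms] .

lemma jordan_length_ranks:
  fixes A :: "'a::field mat"
  assumes A: "A \<in> carrier_mat n n"
  shows "finite {vec_space.rank n (A - c \<cdot>\<^sub>m 1\<^sub>m n) | c. c \<noteq> 0}"
    and "{vec_space.rank n (A - c \<cdot>\<^sub>m 1\<^sub>m n) | c. c \<noteq> 0} \<noteq> {}"
proof -
  have "vec_space.rank n (A - c \<cdot>\<^sub>m 1\<^sub>m n) \<le> n" for c using A by (intro rank_le_dim) auto
  then have "{vec_space.rank n (A - c \<cdot>\<^sub>m 1\<^sub>m n) | c. c \<noteq> 0} \<subseteq> {..n}" by auto
  then show "finite {vec_space.rank n (A - c \<cdot>\<^sub>m 1\<^sub>m n) | c. c \<noteq> 0}" by (rule finite_subset) simp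
  have "vec_space.rank n (A - 1 \<cdot>\<^sub>m 1\<^sub>m n) \<in> {vec_space.rank n (A - c \<cdot>\<^sub>m 1\<^sub>m n) | c. c \<noteq> 0}"
    by (intro CollectI exI[of _ 1]) simp
  then show "{vec_space.rank n (A - c \<cdot>\<^sub>m 1\<^sub>m n) | c. c \<noteq> 0} \<noteq> {}" by (metis empty_iff)
qed

lemma jordan_length_le:
  fixes A :: "'a::field mat"
  assumes "A \<in> carrier_mat n n" "c \<noteq> 0"
  shows "jordan_length n A \<le> real (vec_space.rank n (A - c \<cdot>\<^sub>m 1\<^sub>m n)) / real n"
proof -
  have "Min {vec_space.rank n (A - c \<cdot>\<^sub>m 1\<^sub>m n) | c. c \<noteq> 0} \<le> vec_space.rank n (A - c \<cdot>\<^sub>m 1\<^sub>m n)"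
    using jordan_length_ranks[OF assms(1)] assms(2) by (intro Min_le) auto
  then show ?thesis unfolding jordan_length_def by (simp add: divide_right_mono)
qed

lemma jordan_length_attained:
  fixes A :: "'a::field mat"
  assumes "A \<in> carrier_mat n n"
  obtains c where "c \<noteq> 0" "jordan_length n A = real (vec_space.rank n (A - c \<cdot>\<^sub>m 1\<^sub>m n)) / real n"
proof -
  have "Min {vec_space.rank n (A - c \<cdot>\<^sub>m 1\<^sub>m n) | c. c \<noteq> 0} \<in> {vec_space.rank n (A - c \<cdot>\<^sub>m 1\<^sub>m n) | c. c \<noteq> 0}"
    using jordan_length_ranks[OF assms] by (rule Min_in)
  then obtain c where "c \<noteq> 0" "Min {vec_space.rank n (A - c \<cdot>\<^sub>m 1\<^sub>m n) | c. c \<noteq> 0} = vec_space.rank n (A - c \<cdot>\<^sub>m 1\<^sub>m n)"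
    by blast
  then show thesis using that[of c] unfolding jordan_length_def by simp
qed

lemma jordan_length_bounds:
  fixes A :: "'a::field mat"
  assumes A: "A \<in> carrier_mat n n"
  shows "0 \<le> jordan_length n A" "jordan_length n A \<le> 1"
proof -
  obtain c where c: "jordan_length n A = real (vec_space.rank n (A - c \<cdot>\<^sub>m 1\<^sub>m n)) / real n"
    using jordan_length_attained[OF A] by blast
  show "0 \<le> jordan_length n A" unfolding c by simp
  have "vec_space.rank n (A - c \<cdot>\<^sub>m 1\<^sub>m n) \<le> n" using A by (intro rank_le_dim) auto
  then show "jordan_length n A \<le> 1" unfolding c by (cases "n = 0") auto
qed

text \<open>For optimal scalars \<open>c\<close> and \<open>d\<close>,
  \<open>A B - c d = (A - c) B + c (B - d)\<close>, and the rank is subadditive.\<close>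

lemma jordan_length_mult:
  fixes A B :: "'a::field mat"
  assumes A: "A \<in> carrier_mat n n" and B: "B \<in> carrier_mat n n"
  shows "jordan_length n (A * B) \<le> jordan_length n A + jordan_length n B"
proof -
  obtain c where c: "c \<noteq> 0" "jordan_length n A = real (vec_space.rank n (A - c \<cdot>\<^sub>m 1\<^sub>m n)) / real n"
    using jordan_length_attained[OF A] .
  obtain d where d: "d \<noteq> 0" "jordan_length n B = real (vec_space.rank n (B - d \<cdot>\<^sub>m 1\<^sub>m n)) / real n"
    using jordan_length_attained[OF B] .
  have Ac: "A - c \<cdot>\<^sub>m 1\<^sub>m n \<in> carrier_mat n n" and Bd: "B - d \<cdot>\<^sub>m 1\<^sub>m n \<in> carrier_mat n n" using A B by auto
  have c1: "c \<cdot>\<^sub>m 1\<^sub>m n \<in> carrier_mat n n" by simp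
  have e1: "(A - c \<cdot>\<^sub>m 1\<^sub>m n) * B = A * B - c \<cdot>\<^sub>m B"
    using minus_mult_distrib_mat[OF A c1 B] mult_smult_assoc_mat[OF one_carrier_mat B] B by simp
  have e2: "(B - d \<cdot>\<^sub>m 1\<^sub>m n) * (c \<cdot>\<^sub>m 1\<^sub>m n) = c \<cdot>\<^sub>m B - (c * d) \<cdot>\<^sub>m 1\<^sub>m n"
    using mult_smult_distrib[OF Bd one_carrier_mat] right_mult_one_mat[OF Bd] B
    by (auto intro!: eq_matI simp: algebra_simps)
  have "A * B - (c * d) \<cdot>\<^sub>m 1\<^sub>m n = (A - c \<cdot>\<^sub>m 1\<^sub>m n) * B + (B - d \<cdot>\<^sub>m 1\<^sub>m n) * (c \<cdot>\<^sub>m 1\<^sub>m n)"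
    unfolding e1 e2 using mult_carrier_mat[OF A B] B by (intro eq_matI) auto
  moreover have "vec_space.rank n ((A - c \<cdot>\<^sub>m 1\<^sub>m n) * B + (B - d \<cdot>\<^sub>m 1\<^sub>m n) * (c \<cdot>\<^sub>m 1\<^sub>m n))
     \<le> vec_space.rank n ((A - c \<cdot>\<^sub>m 1\<^sub>m n) * B) + vec_space.rank n ((B - d \<cdot>\<^sub>m 1\<^sub>m n) * (c \<cdot>\<^sub>m 1\<^sub>m n))"
    using vec_space.rank_subadditive[OF mult_carrier_mat[OF Ac B] mult_carrier_mat[OF Bd c1]] .
  moreover have "vec_space.rank n ((A - c \<cdot>\<^sub>m 1\<^sub>m n) * B) \<le> vec_space.rank n (A - c \<cdot>\<^sub>m 1\<^sub>m n)"
    by (rule vec_space.rank_mult_le[OF Ac B])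
  moreover have "vec_space.rank n ((B - d \<cdot>\<^sub>m 1\<^sub>m n) * (c \<cdot>\<^sub>m 1\<^sub>m n)) \<le> vec_space.rank n (B - d \<cdot>\<^sub>m 1\<^sub>m n)"
    by (rule vec_space.rank_mult_le[OF Bd c1])
  ultimately have "real (vec_space.rank n (A * B - (c * d) \<cdot>\<^sub>m 1\<^sub>m n))
     \<le> real (vec_space.rank n (A - c \<cdot>\<^sub>m 1\<^sub>m n)) + real (vec_space.rank n (B - d \<cdot>\<^sub>m 1\<^sub>m n))"
    by (simp flip: of_nat_add)
  then have "real (vec_space.rank n (A * B - (c * d) \<cdot>\<^sub>m 1\<^sub>m n)) / real n \<le> jordan_length n A + jordan_length n B"
    unfolding c(2) d(2) add_divide_distrib[symmetric] by (rule divide_right_mono) simp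
  then show ?thesis using jordan_length_le[OF mult_carrier_mat[OF A B], of "c * d"] c(1) d(1) by simp
qed

lemma jordan_length_similar_le:
  fixes A B :: "'a::field mat"
  assumes A: "A \<in> carrier_mat n n" and AB: "similar_mat A B"
  shows "jordan_length n A \<le> jordan_length n B"
proof -
  have B: "B \<in> carrier_mat n n" using similar_mat_carrier[OF AB A] .
  obtain c where c: "c \<noteq> 0" "jordan_length n B = real (vec_space.rank n (B - c \<cdot>\<^sub>m 1\<^sub>m n)) / real n"
    using jordan_length_attained[OF B] .
  have "vec_space.rank n (A - c \<cdot>\<^sub>m 1\<^sub>m n) = vec_space.rank n (B - c \<cdot>\<^sub>m 1\<^sub>m n)"
    using A by (intro rank_similar similar_mat_minus_scalar[OF A AB]) auto
  then show ?thesis using jordan_length_le[OF A c(1)] c(2) by simp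
qed

lemma jordan_length_similar:
  fixes A B :: "'a::field mat"
  assumes A: "A \<in> carrier_mat n n" and AB: "similar_mat A B"
  shows "jordan_length n A = jordan_length n B"
  using jordan_length_similar_le[OF A AB]
    jordan_length_similar_le[OF similar_mat_carrier[OF AB A] similar_mat_sym[OF AB]] by simp

text \<open>For \<open>c\<close> optimal for \<open>A\<close>, the inverse minus
  \<open>1 / c\<close> equals \<open>- (1 / c) (A - c)\<close> times the inverse.\<close>

lemma jordan_length_inverse_le:
  fixes A :: "'a::field mat"
  assumes A: "A \<in> carrier_mat n n" and Ai: "Ai \<in> carrier_mat n n" "A * Ai = 1\<^sub>m n"
  shows "jordan_length n Ai \<le> jordan_length n A"
proof -
  obtain c where c: "c \<noteq> 0" "jordan_length n A = real (vec_space.rank n (A - c \<cdot>\<^sub>m 1\<^sub>m n)) / real n"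
    using jordan_length_attained[OF A] .
  have Ac: "A - c \<cdot>\<^sub>m 1\<^sub>m n \<in> carrier_mat n n" using A by auto
  have "(A - c \<cdot>\<^sub>m 1\<^sub>m n) * Ai = 1\<^sub>m n - c \<cdot>\<^sub>m Ai"
    using minus_mult_distrib_mat[OF A smult_carrier_mat[OF one_carrier_mat] Ai(1)]
      mult_smult_assoc_mat[OF one_carrier_mat Ai(1)] Ai by simp
  then have "(A - c \<cdot>\<^sub>m 1\<^sub>m n) * ((- (1 / c)) \<cdot>\<^sub>m Ai) = (- (1 / c)) \<cdot>\<^sub>m (1\<^sub>m n - c \<cdot>\<^sub>m Ai)"
    using mult_smult_distrib[OF Ac Ai(1)] by simp
  also have "\<dots> = Ai - (1 / c) \<cdot>\<^sub>m 1\<^sub>m n"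
    using Ai(1) c(1) by (intro eq_matI) (auto simp: algebra_simps)
  finally have "vec_space.rank n (Ai - (1 / c) \<cdot>\<^sub>m 1\<^sub>m n) \<le> vec_space.rank n (A - c \<cdot>\<^sub>m 1\<^sub>m n)"
    using vec_space.rank_mult_le[OF Ac smult_carrier_mat[OF Ai(1)], of "- (1 / c)"] by simp
  then have "real (vec_space.rank n (Ai - (1 / c) \<cdot>\<^sub>m 1\<^sub>m n)) / real n \<le> jordan_length n A"
    unfolding c(2) by (simp add: divide_right_mono)
  then show ?thesis using jordan_length_le[OF Ai(1), of "1 / c"] c(1) by simp
qed

lemma jordan_length_scalar:
  fixes c :: "'a::field"
  assumes "c \<noteq> 0"
  shows "jordan_length n (c \<cdot>\<^sub>m 1\<^sub>m n) = 0"
proof -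
  have C: "c \<cdot>\<^sub>m 1\<^sub>m n \<in> carrier_mat n n" by simp
  have zero: "c \<cdot>\<^sub>m 1\<^sub>m n - c \<cdot>\<^sub>m 1\<^sub>m n = 0\<^sub>m n n" by (rule eq_matI) auto
  have "jordan_length n (c \<cdot>\<^sub>m 1\<^sub>m n) \<le> 0"
    using jordan_length_le[OF C assms] unfolding zero vec_space.rank_0I by simp
  then show ?thesis using jordan_length_bounds(1)[OF C] by linarith
qed

text \<open>Needed for nontriviality of the ultraproduct. A diagonal matrix with distinct entries
  and its cyclic shift are similar, and their difference is invertible. Subtracting the same
  \<open>c\<close> from both gives \<open>n \<le> 2 rank (A - c)\<close>.\<close>

lemma exists_long_element:
  assumes n: "n \<ge> 2"
  shows "\<exists>A\<in>carrier_mat n n. det A = (1::complex) \<and> jordan_length n A \<ge> 1 / 2"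
proof -
  obtain f :: "nat \<Rightarrow> real" where prod: "(\<Prod>i<n. f i) = 1" and inj: "inj_on f {..<n}"
    by (rule obtain_distinct_pos_prod_one[of n]) (use n in simp, rule that)
  define F where "F = (\<lambda>i. complex_of_real (f i))"
  \<comment> \<open>The cyclic shift puts a different entry at every position.\<close>
  define F' where "F' = (\<lambda>i. if i < n - 1 then F (Suc i) else F 0)"
  define A where "A = mat_diag n F"
  define A' where "A' = mat_diag n F'"
  have c: "A \<in> carrier_mat n n" "A' \<in> carrier_mat n n" unfolding A_def A'_def by auto
  have det: "det A = 1" unfolding A_def det_mat_diag F_def of_real_prod[symmetric] prod by simp
  obtain m where m: "n = 1 + m" "n = m + 1" using n that[of "n - 1"] by simp
  have "A = four_block_mat (mat_diag 1 F) (0\<^sub>m 1 m) (0\<^sub>m m 1) (mat_diag m (\<lambda>i. F (Suc i)))"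
    unfolding A_def m(1) by (intro eq_matI) (auto simp: mat_diag_def)
  moreover have "A' = four_block_mat (mat_diag m (\<lambda>i. F (Suc i))) (0\<^sub>m m 1) (0\<^sub>m 1 m) (mat_diag 1 F)"
    unfolding A'_def F'_def m(2) by (intro eq_matI) (auto simp: mat_diag_def)
  ultimately have sim: "similar_mat A A'"
    using similar_mat_swap_blocks[of "mat_diag 1 F" 1 "0\<^sub>m 1 m" m "0\<^sub>m m 1" "mat_diag m (\<lambda>i. F (Suc i))"] by simp
  have "F i \<noteq> F' i" if "i < n" for i
  proof (cases "i < n - 1")
    case True
    then have "Suc i < n" by linarith
    then have "f i \<noteq> f (Suc i)" using inj_onD[OF inj, of i "Suc i"] by auto
    then show ?thesis using True unfolding F'_def F_def by simp
  next
    case False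
    then have "f i \<noteq> f 0" using inj_onD[OF inj, of i 0] that n by auto
    then show ?thesis using False unfolding F'_def F_def by simp
  qed
  then have dd: "det (mat_diag n (\<lambda>i. F i - F' i)) \<noteq> 0" unfolding det_mat_diag by auto
  obtain c where c0: "jordan_length n A = real (vec_space.rank n (A - c \<cdot>\<^sub>m 1\<^sub>m n)) / real n"
    using jordan_length_attained[OF c(1)] by blast
  have Ac: "A - c \<cdot>\<^sub>m 1\<^sub>m n \<in> carrier_mat n n" "A' - c \<cdot>\<^sub>m 1\<^sub>m n \<in> carrier_mat n n" using c by auto
  have m1: "(-1) \<cdot>\<^sub>m 1\<^sub>m n \<in> carrier_mat n n" by simp
  have e: "(A' - c \<cdot>\<^sub>m 1\<^sub>m n) * ((-1) \<cdot>\<^sub>m 1\<^sub>m n) = (-1) \<cdot>\<^sub>m (A' - c \<cdot>\<^sub>m 1\<^sub>m n)"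
    using mult_smult_distrib[OF Ac(2) one_carrier_mat] right_mult_one_mat[OF Ac(2)] by simp
  have "mat_diag n (\<lambda>i. F i - F' i) = (A - c \<cdot>\<^sub>m 1\<^sub>m n) + (A' - c \<cdot>\<^sub>m 1\<^sub>m n) * ((-1) \<cdot>\<^sub>m 1\<^sub>m n)"
    unfolding e by (intro eq_matI) (auto simp: A_def A'_def mat_diag_def)
  then have "n \<le> vec_space.rank n ((A - c \<cdot>\<^sub>m 1\<^sub>m n) + (A' - c \<cdot>\<^sub>m 1\<^sub>m n) * ((-1) \<cdot>\<^sub>m 1\<^sub>m n))"
    using vec_space.low_rank_det_zero[OF mat_diag_dim dd] by simp
  also have "\<dots> \<le> vec_space.rank n (A - c \<cdot>\<^sub>m 1\<^sub>m n) + vec_space.rank n ((A' - c \<cdot>\<^sub>m 1\<^sub>m n) * ((-1) \<cdot>\<^sub>m 1\<^sub>m n))"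
    by (rule vec_space.rank_subadditive[OF Ac(1) mult_carrier_mat[OF Ac(2) m1]])
  also have "vec_space.rank n ((A' - c \<cdot>\<^sub>m 1\<^sub>m n) * ((-1) \<cdot>\<^sub>m 1\<^sub>m n)) \<le> vec_space.rank n (A' - c \<cdot>\<^sub>m 1\<^sub>m n)"
    by (rule vec_space.rank_mult_le[OF Ac(2) m1])
  also have "vec_space.rank n (A' - c \<cdot>\<^sub>m 1\<^sub>m n) = vec_space.rank n (A - c \<cdot>\<^sub>m 1\<^sub>m n)"
    using rank_similar[OF Ac(1) similar_mat_minus_scalar[OF c(1) sim]] by simp
  finally have "real n \<le> 2 * real (vec_space.rank n (A - c \<cdot>\<^sub>m 1\<^sub>m n))" by simp
  then have "1 / 2 \<le> jordan_length n A" unfolding c0 using n by (simp add: field_simps)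
  then show ?thesis using c det by blast
qed

text \<open>Scalars \<open>h\<close> are covered only up to the factor \<open>c\<close>, which is
  enough because scalar errors have length 0.\<close>

lemma conj_products_jordan_length:
  assumes r: "r > 0" and n: "n \<ge> 1"
    and g: "g \<in> carrier_mat n n" and gi: "gi \<in> carrier_mat n n" "g * gi = 1\<^sub>m n"
    and l: "jordan_length n g \<ge> r"
    and h: "h \<in> carrier_mat n n" "det h = (1::complex)"
  shows "\<exists>c h'. c \<noteq> 0 \<and> h' \<in> conj_products n g gi (4 * nat \<lceil>2 / r\<rceil>) \<and> h = c \<cdot>\<^sub>m h'"
proof (cases "\<exists>c. h = c \<cdot>\<^sub>m 1\<^sub>m n")
  case True
  then obtain c where c: "h = c \<cdot>\<^sub>m 1\<^sub>m n" by blast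
  have "c \<noteq> 0" using h(2) n unfolding c by (cases n) auto
  then show ?thesis using c conj_products_one[OF g gi] by blast
next
  case False
  obtain d c U V a b where d: "2 * d \<le> n" "c \<noteq> 0" "U \<in> carrier_mat n (2 * d)" "V \<in> carrier_mat (2 * d) n"
    "g - c \<cdot>\<^sub>m 1\<^sub>m n = U * V" "similar_mat a g" "similar_mat b gi"
    "similar_mat (a * b) (mat_diag n (\<lambda>i. complex_of_real (reciprocal_powers d i)))"
    using conj_pair_diag[OF g gi] by blast
  have s: "mat_diag n (\<lambda>i. complex_of_real (reciprocal_powers d i)) \<in> conj_products n g gi 1"
    using conj_products_similar[OF g gi conj_products_pair[OF g gi d(6,7)] similar_mat_sym[OF d(8)]] .
  have "vec_space.rank n (g - c \<cdot>\<^sub>m 1\<^sub>m n) \<le> 2 * d"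
    unfolding d(5) by (rule vec_space.rank_mult_le_inner[OF d(3,4)])
  then have "r \<le> real (2 * d) / real n"
    using jordan_length_le[OF g d(2)] l divide_right_mono[of "real (vec_space.rank n (g - c \<cdot>\<^sub>m 1\<^sub>m n))" "real (2 * d)" "real n"]
    by simp
  then have rn: "r * real n \<le> real (2 * d)" using n by (simp add: field_simps)
  moreover have "r * real n > 0" using r n by simp
  ultimately have d1: "d \<ge> 1" by (cases d) auto
  \<comment> \<open>From \<open>r * n \<le> 2 * d\<close> and \<open>d \<le> 2 * d - 1\<close> one
    gets \<open>n \<le> K * (2 * d - 1)\<close>; the numerator 2 pays for the second inequality
    together with the factor in the first.\<close>
  define K where "K = nat \<lceil>2 / r\<rceil>"
  have "2 / r \<le> real K" unfolding K_def by linarith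
  then have "2 \<le> real K * r" using r by (simp add: field_simps)
  then have "2 * real n \<le> real K * r * real n" by (intro mult_right_mono) auto
  also have "\<dots> = real K * (r * real n)" by simp
  also have "\<dots> \<le> real K * real (2 * d)" using rn by (intro mult_left_mono) auto
  also have "\<dots> \<le> real K * real (2 * (2 * d - 1))" using d1 by (intro mult_left_mono) auto
  finally have "real n \<le> real (K * (2 * d - 1))" by simp
  then have "n \<le> K * (2 * d - 1) + 1" by linarith
  from conj_products_nonscalar[OF g gi d(1) d1 s this h] False
  have "h \<in> conj_products n g gi (4 * K)" by blast
  moreover have "h = 1 \<cdot>\<^sub>m h" by (rule eq_matI) auto
  ultimately show ?thesis unfolding K_def by (intro exI[of _ 1] exI[of _ h]) simp
qed

section \<open>Metric ultraproducts of pseudo-normed groups\<close>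

text \<open>An exact number of factors in a fixed pattern, unlike in \<open>C_set\<close>, lets
  witnesses be chosen independently in each coordinate of a product group. The right-nested
  bracketing matches \<open>foldr\<close>.\<close>

primrec pair_products :: "('a, 'b) monoid_scheme \<Rightarrow> 'a \<Rightarrow> nat \<Rightarrow> 'a set" where
  "pair_products G g 0 = {\<one>\<^bsub>G\<^esub>}"
| "pair_products G g (Suc k) =
     {(x \<otimes>\<^bsub>G\<^esub> g \<otimes>\<^bsub>G\<^esub> inv\<^bsub>G\<^esub> x) \<otimes>\<^bsub>G\<^esub> ((y \<otimes>\<^bsub>G\<^esub> inv\<^bsub>G\<^esub> g \<otimes>\<^bsub>G\<^esub> inv\<^bsub>G\<^esub> y) \<otimes>\<^bsub>G\<^esub> h) | x y h.
        x \<in> carrier G \<and> y \<in> carrier G \<and> h \<in> pair_products G g k}"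

lemma pair_products_subset_C_set: "pair_products G g k \<subseteq> C_set (2 * k) g G"
proof (induction k)
  case 0
  then show ?case by (auto simp: C_set_def)
next
  case (Suc k)
  show ?case
  proof
    fix z assume "z \<in> pair_products G g (Suc k)"
    then obtain x y h where z: "z = (x \<otimes>\<^bsub>G\<^esub> g \<otimes>\<^bsub>G\<^esub> inv\<^bsub>G\<^esub> x) \<otimes>\<^bsub>G\<^esub> ((y \<otimes>\<^bsub>G\<^esub> inv\<^bsub>G\<^esub> g \<otimes>\<^bsub>G\<^esub> inv\<^bsub>G\<^esub> y) \<otimes>\<^bsub>G\<^esub> h)"
      and xyh: "x \<in> carrier G" "y \<in> carrier G" "h \<in> pair_products G g k" by auto
    obtain xs where xs: "h = foldr (\<otimes>\<^bsub>G\<^esub>) xs \<one>\<^bsub>G\<^esub>" "length xs \<le> 2 * k"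
      "set xs \<subseteq> conjugates G g \<union> conjugates G (inv\<^bsub>G\<^esub> g)"
      using Suc.IH xyh(3) unfolding C_set_def by blast
    let ?ys = "(x \<otimes>\<^bsub>G\<^esub> g \<otimes>\<^bsub>G\<^esub> inv\<^bsub>G\<^esub> x) # (y \<otimes>\<^bsub>G\<^esub> inv\<^bsub>G\<^esub> g \<otimes>\<^bsub>G\<^esub> inv\<^bsub>G\<^esub> y) # xs"
    have "z = foldr (\<otimes>\<^bsub>G\<^esub>) ?ys \<one>\<^bsub>G\<^esub>" unfolding z xs(1) by simp
    moreover have "length ?ys \<le> 2 * Suc k" using xs(2) by simp
    moreover have "set ?ys \<subseteq> conjugates G g \<union> conjugates G (inv\<^bsub>G\<^esub> g)"
      using xs(3) xyh(1,2) unfolding conjugates_def by auto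
    ultimately show "z \<in> C_set (2 * Suc k) g G" unfolding C_set_def by blast
  qed
qed

lemma pair_products_product_group:
  assumes G: "\<And>i. group (G i)" and g: "\<And>i. g i \<in> carrier (G i)"
    and h: "\<And>i. h i \<in> pair_products (G i) (g i) k"
  shows "h \<in> pair_products (product_group UNIV G) g k"
  using h
proof (induction k arbitrary: h)
  case 0
  then show ?case by auto
next
  case (Suc k)
  then have "\<forall>i. \<exists>x y z. h i = (x \<otimes>\<^bsub>G i\<^esub> g i \<otimes>\<^bsub>G i\<^esub> inv\<^bsub>G i\<^esub> x) \<otimes>\<^bsub>G i\<^esub> ((y \<otimes>\<^bsub>G i\<^esub> inv\<^bsub>G i\<^esub> g i \<otimes>\<^bsub>G i\<^esub> inv\<^bsub>G i\<^esub> y) \<otimes>\<^bsub>G i\<^esub> z)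
     \<and> x \<in> carrier (G i) \<and> y \<in> carrier (G i) \<and> z \<in> pair_products (G i) (g i) k" by simp
  then obtain x y z where xyz: "\<And>i. h i = (x i \<otimes>\<^bsub>G i\<^esub> g i \<otimes>\<^bsub>G i\<^esub> inv\<^bsub>G i\<^esub> x i) \<otimes>\<^bsub>G i\<^esub> ((y i \<otimes>\<^bsub>G i\<^esub> inv\<^bsub>G i\<^esub> g i \<otimes>\<^bsub>G i\<^esub> inv\<^bsub>G i\<^esub> y i) \<otimes>\<^bsub>G i\<^esub> z i)"
    "\<And>i. x i \<in> carrier (G i)" "\<And>i. y i \<in> carrier (G i)" "\<And>i. z i \<in> pair_products (G i) (g i) k"
    by metis
  let ?P = "product_group UNIV G"
  have inv: "inv\<^bsub>?P\<^esub> f = (\<lambda>i. inv\<^bsub>G i\<^esub> f i)" if "\<And>i. f i \<in> carrier (G i)" for f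
    using inv_product_group[of f UNIV G] G that by (simp add: PiE_UNIV_domain Pi_iff restrict_def)
  have "h = (x \<otimes>\<^bsub>?P\<^esub> g \<otimes>\<^bsub>?P\<^esub> inv\<^bsub>?P\<^esub> x) \<otimes>\<^bsub>?P\<^esub> ((y \<otimes>\<^bsub>?P\<^esub> inv\<^bsub>?P\<^esub> g \<otimes>\<^bsub>?P\<^esub> inv\<^bsub>?P\<^esub> y) \<otimes>\<^bsub>?P\<^esub> z)"
    using xyz(1) by (auto simp: inv[OF xyz(2)] inv[OF xyz(3)] inv[OF g])
  moreover have "x \<in> carrier ?P" "y \<in> carrier ?P" using xyz(2,3) by auto
  ultimately show ?case using Suc.IH[OF xyz(4)] unfolding pair_products.simps by blast
qed

lemma (in group) pair_products_closed:
  "g \<in> carrier G \<Longrightarrow> h \<in> pair_products G g k \<Longrightarrow> h \<in> carrier G"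
  by (induction k arbitrary: h) auto

lemma (in group_hom) pair_products_hom:
  assumes g: "g \<in> carrier G"
  shows "x \<in> pair_products G g k \<Longrightarrow> h x \<in> pair_products H (h g) k"
proof (induction k arbitrary: x)
  case (Suc k)
  then obtain a b z where z: "x = (a \<otimes> g \<otimes> inv a) \<otimes> ((b \<otimes> inv g \<otimes> inv b) \<otimes> z)"
    "a \<in> carrier G" "b \<in> carrier G" "z \<in> pair_products G g k" by auto
  have "z \<in> carrier G" using G.pair_products_closed[OF g z(4)] .
  then have "h x = (h a \<otimes>\<^bsub>H\<^esub> h g \<otimes>\<^bsub>H\<^esub> inv\<^bsub>H\<^esub> h a) \<otimes>\<^bsub>H\<^esub> ((h b \<otimes>\<^bsub>H\<^esub> inv\<^bsub>H\<^esub> h g \<otimes>\<^bsub>H\<^esub> inv\<^bsub>H\<^esub> h b) \<otimes>\<^bsub>H\<^esub> h z)"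
    unfolding z(1) using z(2,3) g by simp
  moreover have "h a \<in> carrier H" "h b \<in> carrier H" using z(2,3) by auto
  ultimately show ?case using Suc.IH[OF z(4)] unfolding pair_products.simps by blast
qed simp

lemma (in group) C_set_subset_normal:
  assumes N: "H \<lhd> G" and g: "g \<in> H"
  shows "C_set N g G \<subseteq> H"
proof
  have sub: "subgroup H G" and conj: "\<And>x h. x \<in> carrier G \<Longrightarrow> h \<in> H \<Longrightarrow> x \<otimes> h \<otimes> inv x \<in> H"
    using N unfolding normal_inv_iff by auto
  have c: "conjugates G g \<union> conjugates G (inv g) \<subseteq> H"
    using conj g subgroup.m_inv_closed[OF sub g] unfolding conjugates_def by auto
  fix z assume "z \<in> C_set N g G"
  then obtain xs where xs: "z = foldr (\<otimes>) xs \<one>" "set xs \<subseteq> H" using c unfolding C_set_def by auto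
  have "foldr (\<otimes>) xs \<one> \<in> H" using xs(2)
    by (induction xs) (auto intro: subgroup.one_closed[OF sub] subgroup.m_closed[OF sub])
  then show "z \<in> H" using xs by simp
qed

text \<open>The limit is the supremum of the eventual lower bounds. A number above it is no eventual
  lower bound, hence by the ultrafilter dichotomy eventually exceeds \<open>f\<close>.\<close>

lemma ultrafilter_limit:
  fixes f :: "'i \<Rightarrow> real"
  assumes U: "is_ultrafilter U" and f: "\<And>i. a \<le> f i" "\<And>i. f i \<le> b"
  obtains c where "(f \<longlongrightarrow> c) U"
proof -
  have bot: "U \<noteq> bot" and dich: "\<And>P. eventually P U \<or> eventually (\<lambda>i. \<not> P i) U"
    using U unfolding is_ultrafilter_def by auto
  define S where "S = {x. eventually (\<lambda>i. x \<le> f i) U}"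
  have "a \<in> S" unfolding S_def using f(1) by simp
  have "x \<le> b" if xS: "x \<in> S" for x
  proof -
    obtain i where "x \<le> f i" using xS eventually_happens'[OF bot] unfolding S_def by blast
    then show ?thesis using f(2)[of i] by linarith
  qed
  then have bdd: "bdd_above S" by (auto simp: bdd_above_def)
  have "(f \<longlongrightarrow> Sup S) U"
  proof (rule order_tendstoI)
    fix x assume "x < Sup S"
    then obtain y where "y \<in> S" "x < y" using less_cSup_iff[OF _ bdd] \<open>a \<in> S\<close> by blast
    then show "eventually (\<lambda>i. x < f i) U" unfolding S_def by (auto elim: eventually_mono)
  next
    fix x assume x: "Sup S < x"
    then have "x \<notin> S" using cSup_upper[OF _ bdd, of x] by fastforce
    then have "eventually (\<lambda>i. \<not> x \<le> f i) U" using dich[of "\<lambda>i. x \<le> f i"] unfolding S_def by auto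
    then show "eventually (\<lambda>i. f i < x) U" by (auto elim: eventually_mono)
  qed
  then show thesis by (rule that)
qed

text \<open>The common bound 1 guarantees the existence of all ultralimits.\<close>

locale pseudo_normed_groups =
  fixes U :: "'i filter" and G :: "'i \<Rightarrow> 'a monoid" and l :: "'i \<Rightarrow> 'a \<Rightarrow> real"
  assumes ultra: "is_ultrafilter U"
    and grp: "\<And>i. group (G i)"
    and l_nonneg: "\<And>i g. g \<in> carrier (G i) \<Longrightarrow> 0 \<le> l i g"
    and l_le_1: "\<And>i g. g \<in> carrier (G i) \<Longrightarrow> l i g \<le> 1"
    and l_one: "\<And>i. l i \<one>\<^bsub>G i\<^esub> = 0"
    and l_mult: "\<And>i g h. g \<in> carrier (G i) \<Longrightarrow> h \<in> carrier (G i) \<Longrightarrow> l i (g \<otimes>\<^bsub>G i\<^esub> h) \<le> l i g + l i h"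
    and l_inv: "\<And>i g. g \<in> carrier (G i) \<Longrightarrow> l i (inv\<^bsub>G i\<^esub> g) = l i g"
    and l_conj: "\<And>i g x. g \<in> carrier (G i) \<Longrightarrow> x \<in> carrier (G i) \<Longrightarrow> l i (x \<otimes>\<^bsub>G i\<^esub> g \<otimes>\<^bsub>G i\<^esub> inv\<^bsub>G i\<^esub> x) = l i g"
begin

abbreviation "P \<equiv> product_group UNIV G"
abbreviation "E \<equiv> null_sequences U G l"
abbreviation "Q \<equiv> metric_ultraproduct U G l"

lemma U_not_bot: "U \<noteq> bot" using ultra unfolding is_ultrafilter_def by simp

lemma P_group: "group P" using grp by simp

lemma carrier_P: "g \<in> carrier P \<longleftrightarrow> (\<forall>i. g i \<in> carrier (G i))"
  by (auto simp: PiE_UNIV_domain)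

lemma inv_P: "g \<in> carrier P \<Longrightarrow> inv\<^bsub>P\<^esub> g = (\<lambda>i. inv\<^bsub>G i\<^esub> g i)"
  using inv_product_group[of g UNIV G] grp by (simp add: restrict_def)

lemma E_iff: "g \<in> E \<longleftrightarrow> g \<in> carrier P \<and> ((\<lambda>i. l i (g i)) \<longlongrightarrow> 0) U"
  unfolding null_sequences_def by simp

lemma E_normal: "E \<lhd> P"
  unfolding group.normal_inv_iff[OF P_group]
proof (intro conjI ballI)
  interpret P: group P by (rule P_group)
  show "subgroup E P"
  proof (rule P.subgroupI)
    show "E \<subseteq> carrier P" unfolding null_sequences_def by auto
    have "\<one>\<^bsub>P\<^esub> \<in> E" unfolding E_iff using P.one_closed l_one by simp
    then show "E \<noteq> {}" by blast
  next
    fix a assume a: "a \<in> E"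
    then have "a \<in> carrier P" by (simp add: E_iff)
    then show "inv\<^bsub>P\<^esub> a \<in> E"
      using a l_inv P.inv_closed[of a] unfolding E_iff by (simp add: inv_P carrier_P del: carrier_product_group)
  next
    fix a b assume ab: "a \<in> E" "b \<in> E"
    then have c: "a \<in> carrier P" "b \<in> carrier P" by (simp_all add: E_iff)
    have "((\<lambda>i. l i (a i) + l i (b i)) \<longlongrightarrow> 0 + 0) U"
      using ab by (intro tendsto_add) (auto simp: E_iff)
    then have lim: "((\<lambda>i. l i (a i) + l i (b i)) \<longlongrightarrow> 0) U" by simp
    have "((\<lambda>i. l i (a i \<otimes>\<^bsub>G i\<^esub> b i)) \<longlongrightarrow> 0) U"
    proof (rule tendsto_sandwich[OF _ _ tendsto_const lim]; rule always_eventually; rule allI)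
      fix i
      have ci: "a i \<in> carrier (G i)" "b i \<in> carrier (G i)" using c unfolding carrier_P by auto
      then show "0 \<le> l i (a i \<otimes>\<^bsub>G i\<^esub> b i)" using group.is_monoid[OF grp] l_nonneg monoid.m_closed by metis
      show "l i (a i \<otimes>\<^bsub>G i\<^esub> b i) \<le> l i (a i) + l i (b i)" by (rule l_mult[OF ci])
    qed
    then show "a \<otimes>\<^bsub>P\<^esub> b \<in> E" unfolding E_iff using P.m_closed[OF c] by simp
  qed
  fix x h assume x: "x \<in> carrier P" and h: "h \<in> E"
  then have c: "h \<in> carrier P" by (simp add: E_iff)
  have "(\<lambda>i. l i ((x \<otimes>\<^bsub>P\<^esub> h \<otimes>\<^bsub>P\<^esub> inv\<^bsub>P\<^esub> x) i)) = (\<lambda>i. l i (h i))"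
    using x c l_conj unfolding carrier_P by (simp add: inv_P[unfolded carrier_P])
  then show "x \<otimes>\<^bsub>P\<^esub> h \<otimes>\<^bsub>P\<^esub> inv\<^bsub>P\<^esub> x \<in> E"
    using h P.m_closed P.inv_closed x c unfolding E_iff by presburger
qed

sublocale E: normal E P by (rule E_normal)

lemma Q_group: "group Q"
  unfolding metric_ultraproduct_def by (rule E.factorgroup_is_group)

lemma proj_hom: "group_hom P Q (\<lambda>g. E #>\<^bsub>P\<^esub> g)"
  using P_group Q_group E.r_coset_hom_Mod unfolding metric_ultraproduct_def
  by (intro group_hom.intro group_hom_axioms.intro) auto

lemma carrier_Q: "carrier Q = (\<lambda>g. E #>\<^bsub>P\<^esub> g) ` carrier P"
  unfolding metric_ultraproduct_def carrier_FactGroup ..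

lemma one_Q: "\<one>\<^bsub>Q\<^esub> = E"
  unfolding metric_ultraproduct_def by simp

lemma coset_eqI:
  assumes "g \<in> carrier P" "h \<in> carrier P" "g \<otimes>\<^bsub>P\<^esub> inv\<^bsub>P\<^esub> h \<in> E"
  shows "E #>\<^bsub>P\<^esub> g = E #>\<^bsub>P\<^esub> h"
proof -
  have "g = (g \<otimes>\<^bsub>P\<^esub> inv\<^bsub>P\<^esub> h) \<otimes>\<^bsub>P\<^esub> h"
    using E.m_assoc[OF assms(1) E.inv_closed[OF assms(2)] assms(2)] E.l_inv[OF assms(2)] E.r_one[OF assms(1)] by metis
  then have "g \<in> E #>\<^bsub>P\<^esub> h" using assms(3) unfolding r_coset_def by blast
  then show ?thesis using E.repr_independence[OF _ assms(2) E.subgroup_axioms] by blast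
qed

text \<open>Two representatives differ by a null sequence \<open>e\<close>, and their pseudo-norms
  by at most that of \<open>e\<close> in either direction. So the limit depends on the coset only
  and the definite description is justified.\<close>

lemma norm_limit:
  assumes g: "g \<in> carrier P"
  shows "((\<lambda>i. l i (g i)) \<longlongrightarrow> ultraproduct_norm U l (E #>\<^bsub>P\<^esub> g)) U"
proof -
  have gi: "g i \<in> carrier (G i)" for i using g unfolding carrier_P by blast
  obtain c where c: "((\<lambda>i. l i (g i)) \<longlongrightarrow> c) U"
    using ultrafilter_limit[OF ultra, of 0 "\<lambda>i. l i (g i)" 1] l_nonneg[OF gi] l_le_1[OF gi] by blast
  have lim: "((\<lambda>i. l i (x i)) \<longlongrightarrow> c) U" if "x \<in> E #>\<^bsub>P\<^esub> g" for x
  proof -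
    obtain e where e: "e \<in> E" "x = e \<otimes>\<^bsub>P\<^esub> g" using \<open>x \<in> _\<close> unfolding r_coset_def by blast
    have ei: "e i \<in> carrier (G i)" for i using e(1) unfolding E_iff carrier_P by blast
    have xi: "x i = e i \<otimes>\<^bsub>G i\<^esub> g i" for i unfolding e(2) by simp
    have lo: "l i (g i) - l i (e i) \<le> l i (x i)" for i
    proof -
      interpret Gi: group "G i" by (rule grp)
      have "g i = inv\<^bsub>G i\<^esub> e i \<otimes>\<^bsub>G i\<^esub> x i" unfolding xi using ei[of i] gi[of i] by (simp add: Gi.m_assoc[symmetric])
      then have "l i (g i) \<le> l i (inv\<^bsub>G i\<^esub> e i) + l i (x i)"
        using l_mult[of "inv\<^bsub>G i\<^esub> e i" i "x i"] ei[of i] gi[of i] by (simp add: xi)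
      then show ?thesis using l_inv[OF ei[of i]] by simp
    qed
    have hi: "l i (x i) \<le> l i (g i) + l i (e i)" for i
      unfolding xi using l_mult[OF ei[of i] gi[of i]] by simp
    have le: "((\<lambda>i. l i (e i)) \<longlongrightarrow> 0) U" using e(1) unfolding E_iff by blast
    show ?thesis
      by (rule tendsto_sandwich[OF _ _ tendsto_diff[OF c le, unfolded diff_zero] tendsto_add[OF c le, unfolded add_0_right]])
        (use lo hi in auto)
  qed
  have "g \<in> E #>\<^bsub>P\<^esub> g" using group.rcos_self[OF P_group g E.subgroup_axioms] .
  then have "(THE c. \<forall>x\<in>E #>\<^bsub>P\<^esub> g. ((\<lambda>i. l i (x i)) \<longlongrightarrow> c) U) = c"
    using lim tendsto_unique[OF U_not_bot] by (intro the_equality) blast+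
  then show ?thesis using c unfolding ultraproduct_norm_def by simp
qed

lemma norm_nonneg:
  assumes "g \<in> carrier P"
  shows "0 \<le> ultraproduct_norm U l (E #>\<^bsub>P\<^esub> g)"
proof (rule tendsto_lowerbound[OF norm_limit[OF assms] _ U_not_bot])
  have "0 \<le> l i (g i)" for i using assms l_nonneg unfolding carrier_P by blast
  then show "\<forall>\<^sub>F i in U. 0 \<le> l i (g i)" by simp
qed

text \<open>A coset of norm 0 is represented by a null sequence and hence trivial; this supplies a
  positive threshold for every nontrivial element.\<close>

lemma norm_pos:
  assumes X: "X \<in> carrier Q" "X \<noteq> \<one>\<^bsub>Q\<^esub>"
  shows "ultraproduct_norm U l X > 0"
proof -
  obtain g where g: "g \<in> carrier P" "X = E #>\<^bsub>P\<^esub> g" using X(1) unfolding carrier_Q by blast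
  have "ultraproduct_norm U l X \<noteq> 0"
  proof
    assume "ultraproduct_norm U l X = 0"
    then have "g \<in> E" using norm_limit[OF g(1)] g unfolding E_iff by simp
    then have "X = E" using group.coset_join2[OF P_group g(1) E.subgroup_axioms] g(2) by simp
    then show False using X(2) one_Q by simp
  qed
  then show ?thesis using norm_nonneg[OF g(1)] g(2) by simp
qed

text \<open>Only an approximate covering of the factors is needed: errors of pseudo-norm zero vanish in the
  ultraproduct.\<close>

lemma C_set_cover:
  assumes cover: "\<And>i g h. g \<in> carrier (G i) \<Longrightarrow> h \<in> carrier (G i) \<Longrightarrow> r \<le> l i g \<Longrightarrow>
      \<exists>h'\<in>pair_products (G i) g N. l i (h \<otimes>\<^bsub>G i\<^esub> inv\<^bsub>G i\<^esub> h') = 0"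
    and X: "X \<in> carrier Q" "r < ultraproduct_norm U l X"
  shows "carrier Q \<subseteq> C_set (2 * N) X Q"
proof
  fix Y assume "Y \<in> carrier Q"
  then obtain h where h: "h \<in> carrier P" "Y = E #>\<^bsub>P\<^esub> h" unfolding carrier_Q by blast
  obtain g where g: "g \<in> carrier P" "X = E #>\<^bsub>P\<^esub> g" using X(1) unfolding carrier_Q by blast
  have gi: "g i \<in> carrier (G i)" and hi: "h i \<in> carrier (G i)" for i
    using g h unfolding carrier_P by blast+
  have ev: "eventually (\<lambda>i. r < l i (g i)) U"
    using order_tendstoD(1)[OF norm_limit[OF g(1)]] X(2) g(2) by blast
  \<comment> \<open>A filler for the coordinates where \<open>g i\<close> is short: a representative
    must be given at every index, also outside the ultrafilter set.\<close>
  have one: "\<one>\<^bsub>G i\<^esub> \<in> pair_products (G i) (g i) k" for i k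
  proof (induction k)
    case (Suc k)
    interpret Gi: group "G i" by (rule grp)
    have "\<one>\<^bsub>G i\<^esub> = (\<one>\<^bsub>G i\<^esub> \<otimes>\<^bsub>G i\<^esub> g i \<otimes>\<^bsub>G i\<^esub> inv\<^bsub>G i\<^esub> \<one>\<^bsub>G i\<^esub>) \<otimes>\<^bsub>G i\<^esub>
       ((\<one>\<^bsub>G i\<^esub> \<otimes>\<^bsub>G i\<^esub> inv\<^bsub>G i\<^esub> g i \<otimes>\<^bsub>G i\<^esub> inv\<^bsub>G i\<^esub> \<one>\<^bsub>G i\<^esub>) \<otimes>\<^bsub>G i\<^esub> \<one>\<^bsub>G i\<^esub>)"
      using gi[of i] by simp
    then show ?case using Suc Gi.one_closed unfolding pair_products.simps by blast
  qed simp
  have "\<exists>z\<in>pair_products (G i) (g i) N. r < l i (g i) \<longrightarrow> l i (h i \<otimes>\<^bsub>G i\<^esub> inv\<^bsub>G i\<^esub> z) = 0" for i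
    using cover[OF gi hi, of i] one[of i N] by (cases "r < l i (g i)") auto
  then obtain z where z: "\<And>i. z i \<in> pair_products (G i) (g i) N"
    "\<And>i. r < l i (g i) \<Longrightarrow> l i (h i \<otimes>\<^bsub>G i\<^esub> inv\<^bsub>G i\<^esub> z i) = 0" by metis
  have zP: "z \<in> carrier P"
    unfolding carrier_P using group.pair_products_closed[OF grp gi z(1)] by blast
  have "((\<lambda>i. l i (h i \<otimes>\<^bsub>G i\<^esub> inv\<^bsub>G i\<^esub> z i)) \<longlongrightarrow> 0) U"
    by (rule tendsto_eventually, rule eventually_mono[OF ev z(2)])
  moreover have "h \<otimes>\<^bsub>P\<^esub> inv\<^bsub>P\<^esub> z \<in> carrier P"
    using h(1) zP P_group by (metis group.inv_closed group.is_monoid monoid.m_closed)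
  ultimately have "h \<otimes>\<^bsub>P\<^esub> inv\<^bsub>P\<^esub> z \<in> E"
    unfolding E_iff using inv_P[OF zP] by simp
  then have Y: "Y = E #>\<^bsub>P\<^esub> z" using coset_eqI[OF h(1) zP] h(2) by simp
  have "z \<in> pair_products P g N" by (rule pair_products_product_group[OF grp gi z(1)])
  then have "Y \<in> pair_products Q X N"
    unfolding Y g(2) using group_hom.pair_products_hom[OF proj_hom g(1)] by blast
  then show "Y \<in> C_set (2 * N) X Q" by (rule subsetD[OF pair_products_subset_C_set])
qed

text \<open>The number \<open>N\<close> depends on \<open>r\<close> but not on the index, so one
  word length covers the whole ultraproduct. Simplicity follows because a normal subgroup contains
  every product of conjugates of its elements.\<close>

lemma ultraproduct_simple:
  assumes cover: "\<And>r. 0 < r \<Longrightarrow> \<exists>N. \<forall>i. \<forall>g\<in>carrier (G i). \<forall>h\<in>carrier (G i). r \<le> l i g \<longrightarrow>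
      (\<exists>h'\<in>pair_products (G i) g N. l i (h \<otimes>\<^bsub>G i\<^esub> inv\<^bsub>G i\<^esub> h') = 0)"
    and long: "0 < s" "\<And>i. \<exists>g\<in>carrier (G i). s \<le> l i g"
  shows "is_simple Q \<and> metrically_uniformly_simple Q (ultraproduct_norm U l)"
proof
  have C: "\<exists>N. \<forall>X\<in>carrier Q. r < ultraproduct_norm U l X \<longrightarrow> carrier Q \<subseteq> C_set N X Q" if r: "0 < r" for r
  proof -
    obtain N where N: "\<forall>i. \<forall>g\<in>carrier (G i). \<forall>h\<in>carrier (G i). r \<le> l i g \<longrightarrow>
      (\<exists>h'\<in>pair_products (G i) g N. l i (h \<otimes>\<^bsub>G i\<^esub> inv\<^bsub>G i\<^esub> h') = 0)" using cover[OF r] by blast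
    have "carrier Q \<subseteq> C_set (2 * N) X Q" if "X \<in> carrier Q" "r < ultraproduct_norm U l X" for X
      by (rule C_set_cover[OF _ that]) (use N in blast)
    then show ?thesis by blast
  qed
  show "metrically_uniformly_simple Q (ultraproduct_norm U l)"
    unfolding metrically_uniformly_simple_def
  proof (intro allI impI)
    fix t r :: real assume "r < t \<and> 0 < r"
    then obtain N where "\<forall>X\<in>carrier Q. r < ultraproduct_norm U l X \<longrightarrow> carrier Q \<subseteq> C_set N X Q"
      using C by blast
    then show "\<exists>N. \<forall>g\<in>carrier Q. ultraproduct_norm U l g \<in> {r<..t} \<longrightarrow>
        {h \<in> carrier Q. ultraproduct_norm U l h < t} \<subseteq> C_set N g Q"
      by (intro exI[of _ N]) auto
  qed
  show "is_simple Q"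
    unfolding is_simple_def
  proof (intro conjI allI impI)
    show "group Q" by (rule Q_group)
    obtain g where g: "\<And>i. g i \<in> carrier (G i)" "\<And>i. s \<le> l i (g i)" using long(2) by metis
    have gP: "g \<in> carrier P" unfolding carrier_P using g(1) by blast
    have "s \<le> ultraproduct_norm U l (E #>\<^bsub>P\<^esub> g)"
      by (rule tendsto_lowerbound[OF norm_limit[OF gP] _ U_not_bot]) (use g(2) in auto)
    moreover have "((\<lambda>i. l i (\<one>\<^bsub>P\<^esub> i)) \<longlongrightarrow> 0) U" using l_one by simp
    then have "ultraproduct_norm U l (E #>\<^bsub>P\<^esub> \<one>\<^bsub>P\<^esub>) = 0"
      using tendsto_unique[OF U_not_bot norm_limit[OF E.one_closed]] by blast
    ultimately have ne: "E #>\<^bsub>P\<^esub> g \<noteq> E #>\<^bsub>P\<^esub> \<one>\<^bsub>P\<^esub>" using long(1) by auto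
    have "E #>\<^bsub>P\<^esub> g \<in> carrier Q" using gP unfolding carrier_Q by blast
    moreover have "E #>\<^bsub>P\<^esub> \<one>\<^bsub>P\<^esub> = \<one>\<^bsub>Q\<^esub>" by (rule group_hom.hom_one[OF proj_hom])
    ultimately show "carrier Q \<noteq> {\<one>\<^bsub>Q\<^esub>}" using ne by auto
    fix H assume H: "H \<lhd> Q"
    show "H = carrier Q \<or> H = {\<one>\<^bsub>Q\<^esub>}"
    proof (cases "H = {\<one>\<^bsub>Q\<^esub>}")
      case False
      have sub: "subgroup H Q" using H unfolding group.normal_inv_iff[OF Q_group] by blast
      then obtain X where X: "X \<in> H" "X \<noteq> \<one>\<^bsub>Q\<^esub>" using False subgroup.one_closed by fastforce
      have XQ: "X \<in> carrier Q" using X(1) subgroup.subset[OF sub] by blast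
      \<comment> \<open>Half the norm serves as threshold, since the covering asks for strictly
        larger norm.\<close>
      have "0 < ultraproduct_norm U l X / 2" "ultraproduct_norm U l X / 2 < ultraproduct_norm U l X"
        using norm_pos[OF XQ X(2)] by auto
      then obtain N where "carrier Q \<subseteq> C_set N X Q" using C XQ by blast
      then show ?thesis using group.C_set_subset_normal[OF Q_group H X(1)] subgroup.subset[OF sub] by blast
    qed simp
  qed
qed

end

section \<open>Ultraproducts of special linear groups\<close>

lemma special_linear_group_simps [simp]:
  "A \<in> carrier (special_linear_group n) \<longleftrightarrow> A \<in> carrier_mat n n \<and> det A = 1"
  "A \<otimes>\<^bsub>special_linear_group n\<^esub> B = A * B"
  "\<one>\<^bsub>special_linear_group n\<^esub> = 1\<^sub>m n"
  unfolding special_linear_group_def by simp_all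

lemma group_special_linear_group: "group (special_linear_group n :: 'a::field mat monoid)"
proof (rule groupI)
  fix A :: "'a mat" assume A: "A \<in> carrier (special_linear_group n)"
  then obtain B where B: "B \<in> carrier_mat n n" "B * A = 1\<^sub>m n"
    using obtain_inverse_mat[of A n] by auto
  then have "det B = 1" using A det_mult[OF B(1), of A] by simp
  then show "\<exists>B\<in>carrier (special_linear_group n). B \<otimes>\<^bsub>special_linear_group n\<^esub> A = \<one>\<^bsub>special_linear_group n\<^esub>"
    using B by auto
qed (auto simp: det_mult assoc_mult_mat[of _ n n _ n _ n])

lemma inv_special_linear_group:
  fixes A :: "'a::field mat"
  assumes "A \<in> carrier (special_linear_group n)"
  shows "inv\<^bsub>special_linear_group n\<^esub> A \<in> carrier_mat n n" "A * inv\<^bsub>special_linear_group n\<^esub> A = 1\<^sub>m n"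
  using group.inv_closed[OF group_special_linear_group assms] group.r_inv[OF group_special_linear_group assms]
  by auto

lemma complex_root_exists:
  assumes "n \<ge> 1" obtains w :: complex where "w ^ n = z"
proof
  show "(rcis (root n (cmod z)) (Arg z / n)) ^ n = z"
    using assms by (simp add: DeMoivre2 rcis_cmod_Arg)
qed

text \<open>Multiplying the conjugating matrix by an \<open>n\<close>-th root of
  \<open>1 / det P\<close> makes its determinant 1 and leaves the conjugation unchanged.\<close>

lemma similar_conjugate_special_linear:
  fixes A B :: "complex mat"
  assumes n: "n \<ge> 1" and B: "B \<in> carrier_mat n n" and AB: "similar_mat A B"
  obtains X where "X \<in> carrier (special_linear_group n)"
    "A = X \<otimes>\<^bsub>special_linear_group n\<^esub> B \<otimes>\<^bsub>special_linear_group n\<^esub> inv\<^bsub>special_linear_group n\<^esub> X"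
proof -
  let ?G = "special_linear_group n :: complex mat monoid"
  obtain P R where w: "similar_mat_wit A B P R" using AB unfolding similar_mat_def by blast
  have A: "A \<in> carrier_mat n n" using similar_mat_carrier[OF similar_mat_sym[OF AB] B] .
  note d = similar_mat_witD2[OF A w]
  have dP: "det P \<noteq> 0" using mult_eq_one_det_nz[OF d(6,7,1)] .
  obtain c where c: "c ^ n = 1 / det P" using complex_root_exists[OF n] .
  have c0: "c \<noteq> 0" using c dP n by (cases n) auto
  define X where "X = c \<cdot>\<^sub>m P"
  have X: "X \<in> carrier ?G" using d(6) c dP unfolding X_def by simp
  have XR: "X * ((1 / c) \<cdot>\<^sub>m R) = 1\<^sub>m n"
    unfolding X_def using mult_smult_assoc_mat[OF d(6) smult_carrier_mat[OF d(7)]]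
      mult_smult_distrib[OF d(6,7)] d(1) c0 by (simp add: smult_smult_mat) (rule eq_matI, auto)
  have Xc: "X \<in> carrier_mat n n" using X by simp
  have "inv\<^bsub>?G\<^esub> X = (1 / c) \<cdot>\<^sub>m R"
    using right_inverse_mat_unique[OF Xc inv_special_linear_group[OF X] _ XR] d(7) by simp
  moreover have "c \<cdot>\<^sub>m P * B * ((1 / c) \<cdot>\<^sub>m R) = P * B * R"
    using mult_smult_assoc_mat[OF d(6,5)] mult_smult_assoc_mat[OF mult_carrier_mat[OF d(6,5)] smult_carrier_mat[OF d(7)]]
      mult_smult_distrib[OF mult_carrier_mat[OF d(6,5)] d(7)] c0 by (simp add: smult_smult_mat) (rule eq_matI, auto)
  ultimately have "A = X \<otimes>\<^bsub>?G\<^esub> B \<otimes>\<^bsub>?G\<^esub> inv\<^bsub>?G\<^esub> X" using d(3) unfolding X_def by simp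
  then show thesis using that X by blast
qed

lemma conj_products_subset_pair_products:
  fixes g :: "complex mat"
  assumes n: "n \<ge> 1" and g: "g \<in> carrier (special_linear_group n)"
  shows "conj_products n g (inv\<^bsub>special_linear_group n\<^esub> g) k \<subseteq> pair_products (special_linear_group n) g k"
proof (induction k)
  case (Suc k)
  let ?G = "special_linear_group n :: complex mat monoid"
  let ?gi = "inv\<^bsub>?G\<^esub> g"
  have gc: "g \<in> carrier_mat n n" using g by simp
  note gi = inv_special_linear_group[OF g]
  show ?case
  proof
    fix z assume "z \<in> conj_products n g ?gi (Suc k)"
    then obtain a b h where z: "z = a * b * h" "similar_mat a g" "similar_mat b ?gi" "h \<in> conj_products n g ?gi k"
      by auto
    obtain x where x: "x \<in> carrier ?G" "a = x \<otimes>\<^bsub>?G\<^esub> g \<otimes>\<^bsub>?G\<^esub> inv\<^bsub>?G\<^esub> x"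
      using similar_conjugate_special_linear[OF n gc z(2)] .
    obtain y where y: "y \<in> carrier ?G" "b = y \<otimes>\<^bsub>?G\<^esub> ?gi \<otimes>\<^bsub>?G\<^esub> inv\<^bsub>?G\<^esub> y"
      using similar_conjugate_special_linear[OF n gi(1) z(3)] .
    have c: "a \<in> carrier_mat n n" "b \<in> carrier_mat n n" "h \<in> carrier_mat n n"
      using conj_carrier[OF gc gi] conj_products_carrier[OF gc gi] z(2-4) by auto
    have "z = a \<otimes>\<^bsub>?G\<^esub> (b \<otimes>\<^bsub>?G\<^esub> h)" unfolding z(1) using assoc_mult_mat[OF c] by simp
    then show "z \<in> pair_products ?G g (Suc k)"
      unfolding pair_products.simps using x y z(4) Suc by blast
  qed
qed simp

theorem theorem9p3:
  fixes m :: "nat \<Rightarrow> nat" and U :: "nat filter"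
    and G :: "nat \<Rightarrow> complex mat monoid" and l :: "nat \<Rightarrow> complex mat \<Rightarrow> real"
  assumes "\<And>n. m n > 1"
    and "is_ultrafilter U" and "nonprincipal U"
    and "G = (\<lambda>n. special_linear_group (m n))" and "l = (\<lambda>n. jordan_length (m n))"
  shows "is_simple (metric_ultraproduct U G l)
    \<and> metrically_uniformly_simple (metric_ultraproduct U G l) (ultraproduct_norm U l)"
proof -
  have Gi: "G i = special_linear_group (m i)" and li: "l i = jordan_length (m i)" for i
    using assms(4,5) by simp_all
  have c: "g \<in> carrier_mat (m i) (m i)" "det g = 1" if "g \<in> carrier (G i)" for g i
    using that unfolding Gi by simp_all
  interpret pseudo_normed_groups U G l
  proof (rule pseudo_normed_groups.intro)
    show "is_ultrafilter U" by (rule assms(2))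
    show "group (G i)" for i unfolding Gi by (rule group_special_linear_group)
    fix i g assume g: "g \<in> carrier (G i)"
    note gi = inv_special_linear_group[OF g[unfolded Gi], folded Gi]
    show "0 \<le> l i g" "l i g \<le> 1" unfolding li using jordan_length_bounds[OF c(1)[OF g]] by auto
    show "l i (inv\<^bsub>G i\<^esub> g) = l i g"
      unfolding li using jordan_length_inverse_le[OF c(1)[OF g] gi]
        jordan_length_inverse_le[OF gi(1) c(1)[OF g] mat_mult_left_right_inverse[OF c(1)[OF g] gi]] by simp
    fix h assume h: "h \<in> carrier (G i)"
    show "l i (g \<otimes>\<^bsub>G i\<^esub> h) \<le> l i g + l i h"
      unfolding li using jordan_length_mult[OF c(1)[OF g] c(1)[OF h]] by (simp add: Gi)
    note hi = inv_special_linear_group[OF h[unfolded Gi], folded Gi]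
    have "similar_mat (h * g * inv\<^bsub>G i\<^esub> h) g"
      using hi(1) c(1)[OF g] c(1)[OF h]
      by (intro similar_matI[OF _ hi(2) mat_mult_left_right_inverse[OF c(1)[OF h] hi] refl]) auto
    then show "l i (h \<otimes>\<^bsub>G i\<^esub> g \<otimes>\<^bsub>G i\<^esub> inv\<^bsub>G i\<^esub> h) = l i g"
      unfolding li using jordan_length_similar[OF c(1)[OF g] similar_mat_sym] by (simp add: Gi)
  next
    show "l i \<one>\<^bsub>G i\<^esub> = 0" for i
    proof -
      have "\<one>\<^bsub>G i\<^esub> = 1 \<cdot>\<^sub>m 1\<^sub>m (m i)" unfolding Gi by (auto intro: eq_matI)
      then show ?thesis unfolding li using jordan_length_scalar[of 1 "m i"] by simp
    qed
  qed
  show ?thesis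
  proof (rule ultraproduct_simple[of "1 / 2"])
    show "\<exists>g\<in>carrier (G i). 1 / 2 \<le> l i g" for i
      using exists_long_element[of "m i"] assms(1)[of i] unfolding li Gi by auto
    fix r :: real assume r: "0 < r"
    \<comment> \<open>The number of pairs is the same for every size \<open>m i\<close>, as the
      ultraproduct requires.\<close>
    have "\<exists>h'\<in>pair_products (G i) g (4 * nat \<lceil>2 / r\<rceil>). l i (h \<otimes>\<^bsub>G i\<^esub> inv\<^bsub>G i\<^esub> h') = 0"
      if g: "g \<in> carrier (G i)" and h: "h \<in> carrier (G i)" and rl: "r \<le> l i g" for i g h
    proof -
      have m: "m i \<ge> 1" using assms(1)[of i] by simp
      note gi = inv_special_linear_group[OF g[unfolded Gi], folded Gi]
      obtain s h' where s: "s \<noteq> 0" "h' \<in> conj_products (m i) g (inv\<^bsub>G i\<^esub> g) (4 * nat \<lceil>2 / r\<rceil>)" "h = s \<cdot>\<^sub>m h'"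
        using conj_products_jordan_length[OF r m c(1)[OF g] gi rl[unfolded li] c[OF h]] by blast
      have h': "h' \<in> pair_products (G i) g (4 * nat \<lceil>2 / r\<rceil>)"
        using s(2) conj_products_subset_pair_products[OF m g[unfolded Gi]] unfolding Gi by blast
      have "h' \<in> carrier (G i)" using group.pair_products_closed[OF grp g h'] .
      note hi = this c(1)[OF this] inv_special_linear_group[OF this[unfolded Gi], folded Gi]
      \<comment> \<open>The error of the covering is a scalar, which has Jordan length 0 and
        therefore disappears in the ultraproduct.\<close>
      have "h \<otimes>\<^bsub>G i\<^esub> inv\<^bsub>G i\<^esub> h' = s \<cdot>\<^sub>m 1\<^sub>m (m i)"
        unfolding s(3) using mult_smult_assoc_mat[OF hi(2,3)] hi(4) by (simp add: Gi)
      then have "l i (h \<otimes>\<^bsub>G i\<^esub> inv\<^bsub>G i\<^esub> h') = 0" unfolding li using jordan_length_scalar[OF s(1)] by simp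
      then show ?thesis using h' by blast
    qed
    then show "\<exists>N. \<forall>i. \<forall>g\<in>carrier (G i). \<forall>h\<in>carrier (G i). r \<le> l i g \<longrightarrow>
      (\<exists>h'\<in>pair_products (G i) g N. l i (h \<otimes>\<^bsub>G i\<^esub> inv\<^bsub>G i\<^esub> h') = 0)" by blast
  qed simp
qed

end
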